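(* Let $k$ be an algebraically closed field of characteristic $0$ and let $n\ge 3$. If $n$ is even then $\dim(\mathcal E_n)=\dim(\mathcal E_n^* )=\frac{n-2}{2}$; if $n$ is odd then $\dim(\mathcal E_n)=\dim(\mathcal E_n^* )=\frac{n-3}{2}$.
   Context: For $A,B\subseteq k$, $A\le_p B$ means that there is a polynomial $P\in k[X]$ with $A=P^{-1}(B)$; $A\equiv_p B$ means $A\le_p B$ and $B\le_p A$; $[A]$ is the $\equiv_p$-class of $A$. $\mathcal P_n$ is the set of $n$-element subsets of $k$, and $\Sigma_n=\{[A]\mid A\in\mathcal P_n\}$. Two elements of $\mathcal P_n$ are $\equiv_p$-equivalent if and only if one is the image of the other under a linear polynomial $cX+c'$ with $c\neq 0$. Variety structures: let $f_n=\prod_{j\ne j'}(X_j-X_{j'})$ and let $D(f_n)\subseteq k^n$ be the open set of points with pairwise distinct coordinates, an affine variety with ring of regular functions $k[X_1,\ldots,X_n]_{f_n}$. $\mathcal P_n$ is the affine variety obtained as the geometric quotient of $D(f_n)$ by the symmetric group $Sym_n$ permuting coordinates; its regular functions are the $Sym_n$-invariant regular functions on $D(f_n)$. $\Sigma_n$ is the affine variety obtained as the geometric quotient of $\mathcal P_n$ by the action $(P,A)\mapsto P(A)$ of the group of linear polynomials: it has the quotient topology, and its regular functions are the regular functions on $\mathcal P_n$ invariant under this action. Exceptional classes: for $B=\{b_1,\ldots,b_n\}\in\mathcal P_n$ and $\sigma\in Sym_n$, let $\pi_\sigma\subseteq k^n$ be the plane of solutions of the linear system $(b_{\sigma(j)}-b_{\sigma(2)})x_1+(b_{\sigma(1)}-b_{\sigma(j)})x_2+(b_{\sigma(2)}-b_{\sigma(1)})x_j=0$,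 $j\in\{3,\ldots,n\}$. The planes $\pi_\sigma$ are the characteristic planes of $B$; the set $\{\pi_\sigma\mid\sigma\in Sym_n\}$ depends only on $[B]$, and its cardinality is denoted $\chi(B)$. $B$ is an exceptional set, and $[B]$ an exceptional class, if $\chi(B)<n!$. A permutation $\tau$ of $B$ is a characteristic permutation of $B$ if the value $\frac{\tau(b)-\tau(b')}{b-b'}$ is the same for all pairs of distinct $b,b'\in B$; $G_B$ denotes the group of characteristic permutations of $B$. $\mathcal E_n$ is the set of exceptional classes of $\Sigma_n$, and $\mathcal E_n^*$ is the set of exceptional classes $[B]\in\Sigma_n$ such that $G_B$ has even order. Both are Zariski closed subsets (subvarieties) of $\Sigma_n$. *)

theory Defs
  imports
    "HOL-Analysis.Analysis"
    "HOL-Computational_Algebra.Polynomial"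
    "HOL-Combinatorics.Permutations"
    "HOL-Library.Poly_Mapping"
begin

section \<open>Polynomial reducibility and its classes\<close>

definition poly_le :: "'k::comm_semiring_0 set \<Rightarrow> 'k set \<Rightarrow> bool" where
  "poly_le A B \<longleftrightarrow> (\<exists>P. A = poly P -` B)"

definition poly_equiv :: "'k::comm_semiring_0 set \<Rightarrow> 'k set \<Rightarrow> bool" where
  "poly_equiv A B \<longleftrightarrow> poly_le A B \<and> poly_le B A"

definition poly_class :: "'k::comm_semiring_0 set \<Rightarrow> 'k set set" where
  "poly_class A = {B. poly_equiv A B}"

definition nsubsets :: "nat \<Rightarrow> 'k set set" where
  "nsubsets n = {A. finite A \<and> card A = n}"

definition Sigma_classes :: "nat \<Rightarrow> 'k::comm_semiring_0 set set set" where
  "Sigma_classes n = poly_class ` nsubsets n"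

section \<open>Affine space and its Zariski topology\<close>

text \<open>Points of affine \<open>n\<close>-space are functions on \<open>{1..n}\<close>, extended by \<open>undefined\<close>
  outside, so that equality of points is equality of coordinates.\<close>

definition affine_space :: "nat \<Rightarrow> (nat \<Rightarrow> 'k) set" where
  "affine_space n = {1..n} \<rightarrow>\<^sub>E UNIV"

text \<open>A multivariate polynomial is a finitely supported map from monomials to coefficients; a
  monomial is a finitely supported map from variable indices to exponents.\<close>

definition mpolys :: "nat \<Rightarrow> ((nat \<Rightarrow>\<^sub>0 nat) \<Rightarrow>\<^sub>0 'k::comm_ring_1) set" where
  "mpolys n = {p. \<forall>m\<in>Poly_Mapping.keys p. Poly_Mapping.keys m \<subseteq> {1..n}}"

definition monom_eval :: "(nat \<Rightarrow>\<^sub>0 nat) \<Rightarrow> (nat \<Rightarrow> 'k::comm_ring_1) \<Rightarrow> 'k" where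
  "monom_eval m x = (\<Prod>i\<in>Poly_Mapping.keys m. x i ^ Poly_Mapping.lookup m i)"

definition mpoly_eval :: "((nat \<Rightarrow>\<^sub>0 nat) \<Rightarrow>\<^sub>0 'k::comm_ring_1) \<Rightarrow> (nat \<Rightarrow> 'k) \<Rightarrow> 'k" where
  "mpoly_eval p x = (\<Sum>m\<in>Poly_Mapping.keys p. Poly_Mapping.lookup p m * monom_eval m x)"

definition zero_locus ::
    "nat \<Rightarrow> ((nat \<Rightarrow>\<^sub>0 nat) \<Rightarrow>\<^sub>0 'k::comm_ring_1) set \<Rightarrow> (nat \<Rightarrow> 'k) set" where
  "zero_locus n S = {x \<in> affine_space n. \<forall>p\<in>S. mpoly_eval p x = 0}"

definition zariski :: "nat \<Rightarrow> (nat \<Rightarrow> 'k::idom) topology" where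
  "zariski n = topology (\<lambda>U. \<exists>S\<subseteq>mpolys n. U = affine_space n - zero_locus n S)"

lemma monom_eval_superset:
  assumes "finite I" "Poly_Mapping.keys m \<subseteq> I"
  shows "monom_eval m x = (\<Prod>i\<in>I. x i ^ Poly_Mapping.lookup m i)"
  unfolding monom_eval_def
  using assms by (intro prod.mono_neutral_left) (auto simp: in_keys_iff)

lemma monom_eval_add: "monom_eval (m + m') x = monom_eval m x * monom_eval m' x"
proof -
  let ?I = "Poly_Mapping.keys m \<union> Poly_Mapping.keys m'"
  have "Poly_Mapping.keys (m + m') \<subseteq> ?I" by (rule keys_add)
  then show ?thesis
    by (simp add: monom_eval_superset[of ?I] lookup_add power_add prod.distrib)
qed

lemma mpoly_eval_add: "mpoly_eval (p + q) x = mpoly_eval p x + mpoly_eval q x"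
  unfolding mpoly_eval_def
  by (rule setsum_keys_plus_distrib) (simp_all add: algebra_simps)

lemma mpoly_eval_0 [simp]: "mpoly_eval 0 x = 0"
  by (simp add: mpoly_eval_def)

lemma mpoly_eval_1 [simp]: "mpoly_eval 1 x = 1"
  by (simp add: mpoly_eval_def monom_eval_def lookup_one)

lemma mpoly_eval_sum: "mpoly_eval (sum f I) x = (\<Sum>i\<in>I. mpoly_eval (f i) x)"
  by (induction I rule: infinite_finite_induct) (simp_all add: mpoly_eval_add)

lemma mpoly_eval_single: "mpoly_eval (Poly_Mapping.single m a) x = a * monom_eval m x"
  by (cases "a = 0") (simp_all add: mpoly_eval_def)

lemma mpoly_as_sum:
  "p = (\<Sum>m\<in>Poly_Mapping.keys p. Poly_Mapping.single m (Poly_Mapping.lookup p m))"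
  by (rule poly_mapping_eqI)
    (auto simp: lookup_sum lookup_single when_def in_keys_iff)

lemma mpoly_eval_mult: "mpoly_eval (p * q) x = mpoly_eval p x * mpoly_eval q x"
proof -
  have "p * q = (\<Sum>m\<in>Poly_Mapping.keys p. \<Sum>m'\<in>Poly_Mapping.keys q.
      Poly_Mapping.single (m + m') (Poly_Mapping.lookup p m * Poly_Mapping.lookup q m'))"
    using arg_cong2[OF mpoly_as_sum[of p] mpoly_as_sum[of q], of times]
    by (simp only: sum_product mult_single)
  then show ?thesis
    by (simp add: mpoly_eval_sum mpoly_eval_single monom_eval_add mpoly_eval_def[of p]
        mpoly_eval_def[of q] sum_product ac_simps)
qed

lemma mpolys_mult:
  assumes "p \<in> mpolys n" "q \<in> mpolys n"
  shows "p * q \<in> mpolys n"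
proof -
  have "Poly_Mapping.keys m \<subseteq> {1..n}" if "m \<in> Poly_Mapping.keys (p * q)" for m
  proof -
    from that obtain a b where ab: "m = a + b" "a \<in> Poly_Mapping.keys p" "b \<in> Poly_Mapping.keys q"
      using keys_mult[of p q] by blast
    then have "Poly_Mapping.keys a \<subseteq> {1..n}" "Poly_Mapping.keys b \<subseteq> {1..n}"
      using assms by (auto simp: mpolys_def)
    then show ?thesis using keys_add[of a b] ab(1) by blast
  qed
  then show ?thesis by (auto simp: mpolys_def)
qed

lemma istopology_zariski:
  "istopology (\<lambda>U. \<exists>S\<subseteq>(mpolys n :: ((nat \<Rightarrow>\<^sub>0 nat) \<Rightarrow>\<^sub>0 'k::idom) set).
     U = affine_space n - zero_locus n S)"
  unfolding istopology_def
proof (intro conjI allI impI)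
  fix U V :: "(nat \<Rightarrow> 'k) set"
  assume "\<exists>S\<subseteq>mpolys n. U = affine_space n - zero_locus n S"
    and "\<exists>S\<subseteq>mpolys n. V = affine_space n - zero_locus n S"
  then obtain S T where S: "S \<subseteq> mpolys n" "U = affine_space n - zero_locus n S"
    and T: "T \<subseteq> mpolys n" "V = affine_space n - zero_locus n T" by blast
  let ?R = "{p * q | p q. p \<in> S \<and> q \<in> T}"
  have "?R \<subseteq> mpolys n" using S(1) T(1) mpolys_mult by blast
  moreover have "U \<inter> V = affine_space n - zero_locus n ?R"
  proof (intro set_eqI iffI)
    fix x assume "x \<in> U \<inter> V"
    then obtain p q where "p \<in> S" "mpoly_eval p x \<noteq> 0" "q \<in> T" "mpoly_eval q x \<noteq> 0"
      and x: "x \<in> affine_space n" unfolding S(2) T(2) zero_locus_def by blast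
    then have "p * q \<in> ?R" "mpoly_eval (p * q) x \<noteq> 0" by (auto simp only: mpoly_eval_mult mult_eq_0_iff)
    then show "x \<in> affine_space n - zero_locus n ?R"
      using x unfolding zero_locus_def by blast
  next
    fix x assume "x \<in> affine_space n - zero_locus n ?R"
    then obtain p q where "p \<in> S" "q \<in> T" "mpoly_eval (p * q) x \<noteq> 0"
      and x: "x \<in> affine_space n" unfolding zero_locus_def by blast
    then have "mpoly_eval p x \<noteq> 0" "mpoly_eval q x \<noteq> 0"
      by (simp_all add: mpoly_eval_mult)
    then show "x \<in> U \<inter> V"
      using x \<open>p \<in> S\<close> \<open>q \<in> T\<close> unfolding S(2) T(2) zero_locus_def by blast
  qed
  ultimately show "\<exists>R\<subseteq>mpolys n. U \<inter> V = affine_space n - zero_locus n R" by blast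
next
  fix \<K> :: "(nat \<Rightarrow> 'k) set set"
  assume "\<forall>K\<in>\<K>. \<exists>S\<subseteq>mpolys n. K = affine_space n - zero_locus n S"
  then obtain F where F: "\<And>K. K \<in> \<K> \<Longrightarrow> F K \<subseteq> mpolys n"
    "\<And>K. K \<in> \<K> \<Longrightarrow> K = affine_space n - zero_locus n (F K)" by metis
  have "(\<Union>K\<in>\<K>. K) = (\<Union>K\<in>\<K>. affine_space n - zero_locus n (F K))"
    by (rule SUP_cong[OF refl F(2)])
  also have "\<dots> = affine_space n - zero_locus n (\<Union>K\<in>\<K>. F K)"
    by (auto simp: zero_locus_def)
  finally have "\<Union>\<K> = affine_space n - zero_locus n (\<Union>K\<in>\<K>. F K)" by simp
  moreover have "(\<Union>K\<in>\<K>. F K) \<subseteq> mpolys n" using F(1) by blast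
  ultimately show "\<exists>S\<subseteq>mpolys n. \<Union>\<K> = affine_space n - zero_locus n S"
    by blast
qed

lemma openin_zariski:
  "openin (zariski n) U \<longleftrightarrow> (\<exists>S\<subseteq>mpolys n. U = affine_space n - zero_locus n S)"
  unfolding zariski_def by (subst topology_inverse'[OF istopology_zariski]) (rule refl)

lemma topspace_zariski [simp]: "topspace (zariski n) = affine_space n"
proof
  show "topspace (zariski n) \<subseteq> affine_space n"
    unfolding topspace_def by (auto simp: openin_zariski)
  have "1 \<in> mpolys n" by (auto simp: mpolys_def)
  then have "openin (zariski n) (affine_space n)"
    unfolding openin_zariski by (intro exI[of _ "{1}"]) (auto simp: zero_locus_def)
  then show "affine_space n \<subseteq> topspace (zariski n)" by (rule openin_subset)
qed

lemma closedin_zariski: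
  "closedin (zariski n) C \<longleftrightarrow> (\<exists>S\<subseteq>mpolys n. C = zero_locus n S)"
proof -
  have sub: "zero_locus n S \<subseteq> affine_space n" for S :: "((nat \<Rightarrow>\<^sub>0 nat) \<Rightarrow>\<^sub>0 'a) set"
    by (auto simp: zero_locus_def)
  have eq: "C \<subseteq> affine_space n \<and> affine_space n - C = affine_space n - zero_locus n S \<longleftrightarrow>
      C = zero_locus n S" for S
    using sub[of S] by blast
  have "closedin (zariski n) C \<longleftrightarrow> (\<exists>S\<subseteq>mpolys n.
      C \<subseteq> affine_space n \<and> affine_space n - C = affine_space n - zero_locus n S)"
    unfolding closedin_def openin_zariski topspace_zariski by iprover
  then show ?thesis by (simp only: eq)
qed

section \<open>Quotient topologies\<close>

definition quotient_topology :: "'a topology \<Rightarrow> ('a \<Rightarrow> 'b) \<Rightarrow> 'b topology" where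
  "quotient_topology X f =
     topology (\<lambda>U. U \<subseteq> f ` topspace X \<and> openin X {x \<in> topspace X. f x \<in> U})"

lemma openin_quotient_topology:
  "openin (quotient_topology X f) U \<longleftrightarrow>
     U \<subseteq> f ` topspace X \<and> openin X {x \<in> topspace X. f x \<in> U}"
proof -
  have "istopology (\<lambda>U. U \<subseteq> f ` topspace X \<and> openin X {x \<in> topspace X. f x \<in> U})"
    unfolding istopology_def
  proof (intro conjI allI impI)
    fix S T
    assume "S \<subseteq> f ` topspace X \<and> openin X {x \<in> topspace X. f x \<in> S}"
      and "T \<subseteq> f ` topspace X \<and> openin X {x \<in> topspace X. f x \<in> T}"
    moreover have "{x \<in> topspace X. f x \<in> S \<inter> T} =
        {x \<in> topspace X. f x \<in> S} \<inter> {x \<in> topspace X. f x \<in> T}" by auto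
    ultimately show "S \<inter> T \<subseteq> f ` topspace X" "openin X {x \<in> topspace X. f x \<in> S \<inter> T}"
      by auto
  next
    fix \<K>
    assume *: "\<forall>K\<in>\<K>. K \<subseteq> f ` topspace X \<and> openin X {x \<in> topspace X. f x \<in> K}"
    have "{x \<in> topspace X. f x \<in> \<Union>\<K>} = \<Union>((\<lambda>K. {x \<in> topspace X. f x \<in> K}) ` \<K>)" by auto
    with * show "\<Union>\<K> \<subseteq> f ` topspace X" "openin X {x \<in> topspace X. f x \<in> \<Union>\<K>}" by auto
  qed
  then show ?thesis unfolding quotient_topology_def by (simp add: topology_inverse')
qed

lemma topspace_quotient_topology [simp]:
  "topspace (quotient_topology X f) = f ` topspace X"
proof -
  have "{x \<in> topspace X. f x \<in> f ` topspace X} = topspace X" by auto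
  then have "openin (quotient_topology X f) (f ` topspace X)"
    by (simp add: openin_quotient_topology)
  then show ?thesis
    by (metis openin_quotient_topology openin_subset openin_topspace subset_antisym)
qed

lemma quotient_map_quotient_topology: "quotient_map X (quotient_topology X f) f"
  by (auto simp: quotient_map_def openin_quotient_topology)

section \<open>The spaces of n-subsets and of classes\<close>

text \<open>Only the underlying topological spaces are recorded, since the dimension depends on nothing
  else. The open set \<open>D(f\<^sub>n)\<close> consists of the points with pairwise distinct coordinates; the
  fibres of \<open>x \<mapsto> {x\<^sub>1, \<dots>, x\<^sub>n}\<close> on it are the orbits of the symmetric group, and the fibres of
  \<open>A \<mapsto> [A]\<close> are, for \<open>n \<ge> 2\<close>, the orbits of the group of linear polynomials.\<close>

definition distinct_points :: "nat \<Rightarrow> (nat \<Rightarrow> 'k) set" where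
  "distinct_points n = {x \<in> affine_space n. inj_on x {1..n}}"

definition nsubset_space :: "nat \<Rightarrow> 'k::idom set topology" where
  "nsubset_space n =
     quotient_topology (subtopology (zariski n) (distinct_points n)) (\<lambda>x. x ` {1..n})"

definition Sigma_space :: "nat \<Rightarrow> 'k::idom set set topology" where
  "Sigma_space n = quotient_topology (nsubset_space n) poly_class"

lemma image_distinct_points: "(\<lambda>x. x ` {1..n}) ` distinct_points n = nsubsets n"
proof
  show "(\<lambda>x. x ` {1..n}) ` distinct_points n \<subseteq> nsubsets n"
    by (auto simp: distinct_points_def nsubsets_def card_image)
  show "nsubsets n \<subseteq> (\<lambda>x. x ` {1..n}) ` (distinct_points n :: (nat \<Rightarrow> 'a) set)"
  proof
    fix A :: "'a set" assume "A \<in> nsubsets n"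
    then obtain h where h: "bij_betw h {1..n} A"
      using ex_bij_betw_nat_finite_1 by (auto simp: nsubsets_def)
    then have "inj_on (restrict h {1..n}) {1..n}"
      by (simp add: bij_betw_def)
    then have "restrict h {1..n} \<in> distinct_points n"
      by (simp add: distinct_points_def affine_space_def)
    moreover have "A = restrict h {1..n} ` {1..n}" using h by (simp add: bij_betw_def)
    ultimately show "A \<in> (\<lambda>x. x ` {1..n}) ` distinct_points n" by blast
  qed
qed

lemma topspace_nsubset_space [simp]: "topspace (nsubset_space n) = nsubsets n"
proof -
  have "affine_space n \<inter> distinct_points n = (distinct_points n :: (nat \<Rightarrow> 'a) set)"
    by (auto simp: distinct_points_def)
  then show ?thesis
    using image_distinct_points[of n, where 'a = 'a] by (simp add: nsubset_space_def)
qed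

lemma topspace_Sigma_space [simp]: "topspace (Sigma_space n) = Sigma_classes n"
  by (simp add: Sigma_space_def Sigma_classes_def)

section \<open>Characteristic planes and exceptional classes\<close>

definition char_plane :: "nat \<Rightarrow> (nat \<Rightarrow> 'k::comm_ring_1) \<Rightarrow> (nat \<Rightarrow> nat) \<Rightarrow> (nat \<Rightarrow> 'k) set" where
  "char_plane n b \<sigma> = {x \<in> affine_space n. \<forall>j\<in>{3..n}.
     (b (\<sigma> j) - b (\<sigma> 2)) * x 1 + (b (\<sigma> 1) - b (\<sigma> j)) * x 2 + (b (\<sigma> 2) - b (\<sigma> 1)) * x j = 0}"

definition char_planes :: "nat \<Rightarrow> (nat \<Rightarrow> 'k::comm_ring_1) \<Rightarrow> (nat \<Rightarrow> 'k) set set" where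
  "char_planes n b = char_plane n b ` {\<sigma>. \<sigma> permutes {1..n}}"

text \<open>The choice of the enumeration \<open>b\<^sub>1, \<dots>, b\<^sub>n\<close> of \<open>B\<close> is immaterial; see \<open>chi_eq\<close> below.\<close>

definition chi :: "nat \<Rightarrow> 'k::comm_ring_1 set \<Rightarrow> nat" where
  "chi n B = card (char_planes n (SOME b. bij_betw b {1..n} B))"

definition exceptional_set :: "nat \<Rightarrow> 'k::comm_ring_1 set \<Rightarrow> bool" where
  "exceptional_set n B \<longleftrightarrow> B \<in> nsubsets n \<and> chi n B < fact n"

definition char_perm_group :: "'k::field set \<Rightarrow> ('k \<Rightarrow> 'k) set" where
  "char_perm_group B = {\<tau>. \<tau> permutes B \<and>
     (\<exists>c. \<forall>b\<in>B. \<forall>b'\<in>B. b \<noteq> b' \<longrightarrow> (\<tau> b - \<tau> b') / (b - b') = c)}"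

definition exceptional_classes :: "nat \<Rightarrow> 'k::field set set set" where
  "exceptional_classes n = poly_class ` {B. exceptional_set n B}"

definition even_exceptional_classes :: "nat \<Rightarrow> 'k::field set set set" where
  "even_exceptional_classes n =
     poly_class ` {B. exceptional_set n B \<and> even (card (char_perm_group B))}"

lemma char_planes_enum_subset:
  assumes b: "bij_betw b {1..n} B" and c: "bij_betw c {1..n} B"
  shows "char_planes n b \<subseteq> char_planes n c"
proof
  fix L assume "L \<in> char_planes n b"
  then obtain \<sigma> where \<sigma>: "\<sigma> permutes {1..n}" and L: "L = char_plane n b \<sigma>"
    by (auto simp: char_planes_def)
  define \<rho> where "\<rho> i = (if i \<in> {1..n} then inv_into {1..n} c (b (\<sigma> i)) else i)" for i
  have "bij_betw (inv_into {1..n} c \<circ> (b \<circ> \<sigma>)) {1..n} {1..n}"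
    using bij_betw_trans[OF bij_betw_trans[OF permutes_imp_bij[OF \<sigma>] b] bij_betw_inv_into[OF c]] .
  then have "bij_betw \<rho> {1..n} {1..n}"
    by (rule bij_betw_cong[THEN iffD1, rotated]) (simp add: \<rho>_def)
  then have \<rho>: "\<rho> permutes {1..n}"
    by (rule bij_imp_permutes) (auto simp: \<rho>_def)
  have eq: "c (\<rho> i) = b (\<sigma> i)" if "i \<in> {1..n}" for i
  proof -
    have "b (\<sigma> i) \<in> c ` {1..n}"
      using that permutes_in_image[OF \<sigma>, of i] b c by (auto simp: bij_betw_def)
    then show ?thesis using that by (simp add: \<rho>_def f_inv_into_f)
  qed
  have "char_plane n b \<sigma> = char_plane n c \<rho>"
    unfolding char_plane_def using eq by (intro Collect_cong conj_cong ball_cong refl) auto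
  then show "L \<in> char_planes n c" using L \<rho> by (auto simp: char_planes_def)
qed

lemma chi_eq:
  assumes "bij_betw b {1..n} B"
  shows "chi n B = card (char_planes n b)"
proof -
  have "bij_betw (SOME b. bij_betw b {1..n} B) {1..n} B"
    using assms by (rule someI[where P = "\<lambda>b. bij_betw b {1..n} B"])
  then show ?thesis
    unfolding chi_def using char_planes_enum_subset assms by (metis subset_antisym)
qed

section \<open>Dimension\<close>

definition irreducible_space :: "'a topology \<Rightarrow> bool" where
  "irreducible_space X \<longleftrightarrow> topspace X \<noteq> {} \<and>
     (\<forall>C D. closedin X C \<and> closedin X D \<and> topspace X = C \<union> D \<longrightarrow>
        C = topspace X \<or> D = topspace X)"

text \<open>The values are extended reals so that spaces with unbounded chains have dimension \<open>\<infinity>\<close> and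
  the empty space has dimension \<open>-\<infinity>\<close>, in particular not \<open>0\<close>.\<close>

definition krull_dim :: "'a topology \<Rightarrow> ereal" where
  "krull_dim X = Sup {ereal (real m) | m. \<exists>Z.
     (\<forall>i\<le>m. closedin X (Z i) \<and> irreducible_space (subtopology X (Z i))) \<and>
     (\<forall>i<m. Z i \<subset> Z (Suc i))}"

end

theory Submission
  imports Defs
begin

text \<open>
  The exceptional sets are the sets with a nontrivial affine symmetry. Two equal characteristic
  planes of \<open>B\<close> belonging to different permutations give an affine map \<open>t \<mapsto> a t + c\<close> that permutes
  \<open>B\<close> (\<open>exceptional_imp_affine_symmetry\<close>), and \<open>a \<noteq> 1\<close>, because a finite set in characteristic \<open>0\<close>
  is not invariant under a translation. After moving the fixed point to \<open>0\<close>, the set \<open>B\<close> is invariant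
  under multiplication by a root of unity \<open>a \<noteq> 1\<close>, so the elements of \<open>B\<close> other than \<open>0\<close> fall into
  at most \<open>n div 2\<close> orbits, as each of them has at least two elements. After scaling, one orbit representative is \<open>1\<close>. Hence every exceptional
  class is described by \<open>n div 2 - 1\<close> parameters and one of finitely many combinatorial patterns
  (\<open>exceptional_class_parametrization\<close>). The sets with \<open>B = -B\<close> use all these parameters, and they
  have an even symmetry group. So both varieties have dimension \<open>d = n div 2 - 1\<close>.

  For the upper bound, in a chain of irreducible closed sets
  \<open>Z\<^sub>0 \<subset> \<dots> \<subset> Z\<^sub>m\<close> choose regular functions \<open>g\<^sub>i\<close> on the space of classes such that \<open>g\<^sub>i\<close>
  vanishes on \<open>Z\<^sub>i\<close> but not on \<open>Z\<^bsub>i+1\<^esub>\<close>; such functions exist by \<open>regular_separation\<close>. Then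
  \<open>g\<^sub>0, \<dots>, g\<^bsub>m-1\<^esub>\<close> are algebraically independent on \<open>Z\<^sub>m\<close> (\<open>chain_algebraically_independent\<close>): in a
  relation, cancel the largest possible power of the last function, which is allowed because \<open>Z\<^sub>m\<close>
  is irreducible, and restrict to \<open>Z\<^bsub>m-1\<^esub>\<close>, where the last function is \<open>0\<close>. On the other hand,
  \<open>d + 1\<close> rational functions of \<open>d\<close> parameters satisfy a polynomial relation, since there are more
  monomials of bounded degree in \<open>d + 1\<close> functions than coefficients of polynomials in \<open>d\<close> variables
  (\<open>algebraically_dependent_by_counting\<close>). The count still works when finitely many patterns have to
  satisfy one relation simultaneously. So \<open>m \<le> d\<close>.

  For the lower bound let \<open>L = n - 2 i\<close> and consider the sets \<open>B = -B\<close> that contain the progression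
  \<open>-(L - 1), -(L - 3), \<dots>, L - 1\<close>. The closures of these families for \<open>i = 0, \<dots>, d\<close> form a chain.
  Each closure is irreducible, because its family is the image of a piece of an affine subspace
  (\<open>irreducible_closure_of_line_closed\<close>). The chain is strict, because to contain an affine copy of
  a progression of length \<open>L\<close> is a closed condition (\<open>closedin_has_progression\<close>), and it fails for a
  set that consists of the next shorter progression and numbers \<open>\<plusminus> 4 n 4\<^sup>j\<close>
  (\<open>no_progression\<close>).
\<close>

section \<open>Polynomial functions\<close>

text \<open>The induction principle for polynomial expressions: a property of functions that survives sums and
  products and holds for constants and for all substituted coordinates \<open>\<lambda>z. c z i\<close> holds for the
  result of the substitution. It is applied to polynomials on a line, to regular functions, and to
  polynomials in the parameters of the exceptional classes.\<close>

lemma mpoly_eval_closure: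
  fixes Q :: "('a \<Rightarrow> 'k::comm_ring_1) \<Rightarrow> bool"
  assumes const: "\<And>c. Q (\<lambda>z. c)"
    and add: "\<And>f g. Q f \<Longrightarrow> Q g \<Longrightarrow> Q (\<lambda>z. f z + g z)"
    and mult: "\<And>f g. Q f \<Longrightarrow> Q g \<Longrightarrow> Q (\<lambda>z. f z * g z)"
    and coord: "\<And>i. i \<in> {1..n} \<Longrightarrow> Q (\<lambda>z. c z i)"
    and p: "p \<in> mpolys n"
  shows "Q (\<lambda>z. mpoly_eval p (c z))"
proof -
  have pow: "Q (\<lambda>z. f z ^ e)" if "Q f" for f :: "'a \<Rightarrow> 'k" and e
    by (induction e) (auto intro: const mult that)
  have prod: "Q (\<lambda>z. \<Prod>i\<in>I. f i z)" if "\<And>i. i \<in> I \<Longrightarrow> Q (f i)" for I :: "nat set" and f :: "nat \<Rightarrow> 'a \<Rightarrow> 'k"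
    using that by (induction I rule: infinite_finite_induct) (auto intro: const mult)
  have sum: "Q (\<lambda>z. \<Sum>i\<in>I. f i z)" if "\<And>i. i \<in> I \<Longrightarrow> Q (f i)"
    for I :: "(nat \<Rightarrow>\<^sub>0 nat) set" and f :: "(nat \<Rightarrow>\<^sub>0 nat) \<Rightarrow> 'a \<Rightarrow> 'k"
    using that by (induction I rule: infinite_finite_induct) (auto intro: const add)
  have "Q (\<lambda>z. c z i)" if "m \<in> Poly_Mapping.keys p" "i \<in> Poly_Mapping.keys m" for m i
    using p that coord by (force simp: mpolys_def)
  then show ?thesis
    unfolding mpoly_eval_def monom_eval_def by (intro sum mult const prod pow)
qed

definition poly_function :: "nat \<Rightarrow> ((nat \<Rightarrow> 'k::comm_ring_1) \<Rightarrow> 'k) \<Rightarrow> bool" where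
  "poly_function n h \<longleftrightarrow> (\<exists>p\<in>mpolys n. \<forall>x. h x = mpoly_eval p x)"

lemma poly_function_const [intro]: "poly_function n (\<lambda>x. c)"
  unfolding poly_function_def
  by (rule bexI[of _ "Poly_Mapping.single 0 c"])
    (auto simp: mpolys_def mpoly_eval_single monom_eval_def split: if_splits)

lemma poly_function_coord: "i \<in> {1..n} \<Longrightarrow> poly_function n (\<lambda>x. x i)"
  unfolding poly_function_def
  by (rule bexI[of _ "Poly_Mapping.single (Poly_Mapping.single i 1) 1"])
    (auto simp: mpolys_def mpoly_eval_single monom_eval_def)

lemma poly_function_add [intro]:
  assumes "poly_function n f" "poly_function n g"
  shows "poly_function n (\<lambda>x. f x + g x)"
proof -
  obtain p q where "p \<in> mpolys n" "q \<in> mpolys n"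
    and fg: "\<And>x. f x = mpoly_eval p x" "\<And>x. g x = mpoly_eval q x"
    using assms by (auto simp: poly_function_def)
  then have "p + q \<in> mpolys n"
    using keys_add[of p q] unfolding mpolys_def by blast
  then show ?thesis
    unfolding poly_function_def by (intro bexI[of _ "p + q"]) (auto simp: mpoly_eval_add fg)
qed

lemma poly_function_mult [intro]:
  assumes "poly_function n f" "poly_function n g"
  shows "poly_function n (\<lambda>x. f x * g x)"
  using assms mpolys_mult mpoly_eval_mult unfolding poly_function_def by metis

lemma poly_function_diff:
  assumes "poly_function n f" "poly_function n g"
  shows "poly_function n (\<lambda>x. f x - g x)"
  using poly_function_add[OF assms(1) poly_function_mult[OF poly_function_const[of n "-1"] assms(2)]]
  by simp

lemma mpoly_eval_on_line:
  fixes u v :: "nat \<Rightarrow> 'k::comm_ring_1"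
  assumes "p \<in> mpolys n"
  shows "\<exists>P. \<forall>t. mpoly_eval p (\<lambda>i\<in>{1..n}. u i + t * v i) = poly P t"
proof (rule mpoly_eval_closure[where Q = "\<lambda>f. \<exists>P. \<forall>t. f t = poly P t", OF _ _ _ _ assms])
  show "\<exists>P. \<forall>t. c = poly P t" for c :: 'k
    by (rule exI[of _ "[:c:]"]) simp
  show "\<exists>P. \<forall>t. f t + g t = poly P t" if "\<exists>P. \<forall>t. f t = poly P t" "\<exists>P. \<forall>t. g t = poly P t"
    for f g :: "'k \<Rightarrow> 'k"
    using that by (metis poly_add)
  show "\<exists>P. \<forall>t. f t * g t = poly P t" if "\<exists>P. \<forall>t. f t = poly P t" "\<exists>P. \<forall>t. g t = poly P t"
    for f g :: "'k \<Rightarrow> 'k"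
    using that by (metis poly_mult)
  show "\<exists>P. \<forall>t. (\<lambda>i\<in>{1..n}. u i + t * v i) i = poly P t" if "i \<in> {1..n}" for i
    by (rule exI[of _ "[:u i, v i:]"]) (use that in simp)
qed

section \<open>Polynomial equivalence of finite sets is affine equivalence\<close>

lemma poly_class_eq_iff:
  "poly_class A = poly_class B \<longleftrightarrow> poly_equiv A (B :: 'k::comm_semiring_1 set)"
proof -
  have refl: "poly_equiv A A" for A :: "'k set"
    unfolding poly_equiv_def poly_le_def by (auto intro!: exI[of _ "[:0, 1:]"])
  have "poly_le A C" if "poly_le A B" "poly_le B C" for A B C :: "'k set"
  proof -
    obtain P R where "A = poly P -` B" "B = poly R -` C"
      using \<open>poly_le A B\<close> \<open>poly_le B C\<close> by (auto simp: poly_le_def)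
    then have "A = poly (R \<circ>\<^sub>p P) -` C" by (auto simp: poly_pcompose)
    then show ?thesis by (auto simp: poly_le_def)
  qed
  then have "poly_equiv A C" if "poly_equiv A B" "poly_equiv B C" for A B C :: "'k set"
    using that unfolding poly_equiv_def by blast
  moreover have "poly_equiv B A" if "poly_equiv A B" for A B :: "'k set"
    using that unfolding poly_equiv_def by blast
  ultimately show ?thesis
    using refl unfolding poly_class_def by (metis (mono_tags, lifting) Collect_cong mem_Collect_eq)
qed

lemma poly_class_affine_image:
  fixes A :: "'k::field set"
  assumes "a \<noteq> 0"
  shows "poly_class ((\<lambda>t. a * t + b) ` A) = poly_class A"
proof -
  have "A = poly [:b, a:] -` ((\<lambda>t. a * t + b) ` A)"
    using assms by (auto simp: algebra_simps)
  moreover have "(\<lambda>t. a * t + b) ` A = poly [:- b / a, 1 / a:] -` A"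
  proof (intro set_eqI iffI)
    fix t assume "t \<in> poly [:- b / a, 1 / a:] -` A"
    then have "(t - b) / a \<in> A" by (simp add: diff_divide_distrib)
    moreover have "t = a * ((t - b) / a) + b" using assms by simp
    ultimately show "t \<in> (\<lambda>t. a * t + b) ` A" by blast
  qed (use assms in \<open>auto simp: divide_simps\<close>)
  ultimately show ?thesis
    unfolding poly_class_eq_iff poly_equiv_def poly_le_def by metis
qed

text \<open>Dividing by \<open>X - a\<close> leaves a polynomial whose only possible root is \<open>a\<close>; over an algebraically
  closed field the division can be repeated until the quotient is constant.\<close>

lemma poly_with_unique_root:
  fixes P :: "'k::alg_closed_field poly"
  assumes "degree P > 0" and uniq: "\<And>t. poly P t = 0 \<Longrightarrow> t = a"
  shows "P = smult (lead_coeff P) ([:- a, 1:] ^ degree P)"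
  using assms
proof (induction "degree P" arbitrary: P)
  case (Suc m)
  obtain t where "poly P t = 0" using alg_closed_imp_poly_has_root[of P] Suc.prems(1) by auto
  then have "poly P a = 0" using Suc.prems(2) by metis
  then obtain R where R: "P = [:- a, 1:] * R" by (auto simp: poly_eq_0_iff_dvd)
  have "R \<noteq> 0" using R Suc.hyps(2) by auto
  then have deg: "degree P = Suc (degree R)" unfolding R by (subst degree_mult_eq) auto
  have lead: "lead_coeff P = lead_coeff R" unfolding R by (subst lead_coeff_mult) simp
  have "R = smult (lead_coeff R) ([:- a, 1:] ^ degree R)"
  proof (cases "degree R = 0")
    case True
    then show ?thesis by (auto elim!: degree_eq_zeroE)
  next
    case False
    have "m = degree R" using Suc.hyps(2) deg by simp
    moreover have "t = a" if "poly R t = 0" for t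
      using that Suc.prems(2)[of t] R by simp
    ultimately show ?thesis using False Suc.hyps(1)[of R] by simp
  qed
  then have "P = [:- a, 1:] * smult (lead_coeff R) ([:- a, 1:] ^ degree R)"
    using R by metis
  then have "P = smult (lead_coeff R) ([:- a, 1:] ^ Suc (degree R))"
    by (metis mult_smult_right power_Suc)
  then show ?case using deg lead by metis
qed simp

text \<open>If two fibres of \<open>P\<close> are single points \<open>a\<close> and \<open>a'\<close>, then \<open>P\<close> differs from a multiple of
  \<open>(X - a)\<^sup>m\<close> and from the same multiple of \<open>(X - a')\<^sup>m\<close> by constants, \<open>m\<close> being the degree of \<open>P\<close>.
  In characteristic \<open>0\<close> equality of the derivatives forces \<open>a = a'\<close> unless \<open>m = 1\<close>.\<close>

lemma degree_eq_1_of_two_single_fibres: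
  fixes P :: "'k::{alg_closed_field, field_char_0} poly"
  assumes "degree P > 0" "b \<noteq> b'"
    and fib: "\<And>t. poly P t = b \<longleftrightarrow> t = a" "\<And>t. poly P t = b' \<longleftrightarrow> t = a'"
  shows "degree P = 1"
proof (rule ccontr)
  assume "degree P \<noteq> 1"
  then have d: "degree P \<ge> 2" using assms(1) by simp
  define e where "e = degree P - 1"
  have shape: "P - [:v:] = smult (lead_coeff P) ([:- u, 1:] ^ Suc e)"
    if "\<And>t. poly P t = v \<longleftrightarrow> t = u" for u v
  proof -
    have deg: "degree (P - [:v:]) = degree P"
      using assms(1) by (metis degree_add_eq_left degree_pCons_0 diff_conv_add_uminus minus_pCons minus_zero)
    moreover have "lead_coeff (P - [:v:]) = lead_coeff P"
      unfolding deg using assms(1) by (simp add: coeff_pCons split: nat.split)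
    ultimately show ?thesis
      using poly_with_unique_root[of "P - [:v:]" u] assms(1) that e_def by auto
  qed
  have "pderiv (P - [:b:]) = pderiv (P - [:b':])" by (simp add: pderiv_diff pderiv_pCons)
  then have "poly (pderiv (smult (lead_coeff P) ([:- a, 1:] ^ Suc e))) a =
      poly (pderiv (smult (lead_coeff P) ([:- a', 1:] ^ Suc e))) a"
    using shape[OF fib(1)] shape[OF fib(2)] by metis
  moreover have "lead_coeff P \<noteq> 0" using assms(1) by auto
  moreover have "e > 0" using d e_def by simp
  ultimately have "(a - a') ^ e = 0 ^ e"
    by (simp add: pderiv_smult pderiv_power_Suc pderiv_pCons del: of_nat_Suc power_Suc)
  then have "a = a'" using \<open>e > 0\<close> by (simp add: zero_power)
  then show False using fib assms(2) by metis
qed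

text \<open>A polynomial \<open>P\<close> with \<open>A = P\<^bsup>-1\<^esup>(B)\<close> maps \<open>A\<close> onto \<open>B\<close>, since \<open>k\<close> is algebraically closed. As
  the cardinalities agree, all fibres over \<open>B\<close> are single points.\<close>

lemma poly_class_eq_imp_affine_image:
  fixes A B :: "'k::{alg_closed_field, field_char_0} set"
  assumes "A \<in> nsubsets n" "B \<in> nsubsets n" "n \<ge> 2" "poly_class A = poly_class B"
  obtains a b where "a \<noteq> 0" "B = (\<lambda>t. a * t + b) ` A"
proof -
  have fin: "finite A" "finite B" "card A = n" "card B = n"
    using assms by (auto simp: nsubsets_def)
  obtain P where P: "A = poly P -` B"
    using assms(4) unfolding poly_class_eq_iff poly_equiv_def poly_le_def by blast
  have deg: "degree P > 0"
  proof (rule ccontr)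
    assume "\<not> degree P > 0"
    then obtain c where "P = [:c:]" by (auto elim: degree_eq_zeroE)
    then have "A = {} \<or> A = UNIV" using P by auto
    then show False using fin assms(3) infinite_UNIV_char_0[where 'a = 'k] by auto
  qed
  have surj: "poly P ` A = B"
  proof
    show "B \<subseteq> poly P ` A"
    proof
      fix b assume "b \<in> B"
      have "degree (P - [:b:]) = degree P"
        using deg by (metis degree_add_eq_left degree_pCons_0 diff_conv_add_uminus minus_pCons minus_zero)
      then obtain t where "poly (P - [:b:]) t = 0"
        using alg_closed_imp_poly_has_root deg by metis
      then show "b \<in> poly P ` A" using \<open>b \<in> B\<close> P by auto
    qed
  qed (use P in auto)
  then have inj: "inj_on (poly P) A" using fin by (simp add: eq_card_imp_inj_on)
  have "\<not> card A \<le> 1" using fin assms(3) by simp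
  then obtain a a' where a: "a \<in> A" "a' \<in> A" "a \<noteq> a'"
    using card_le_Suc0_iff_eq[OF fin(1)] by auto
  have fib: "poly P t = poly P u \<longleftrightarrow> t = u" if "u \<in> A" for t u
    using that P inj by (auto simp: inj_on_def)
  have "degree P = 1"
    using degree_eq_1_of_two_single_fibres[OF deg, of "poly P a" "poly P a'" a a'] fib a by metis
  then obtain c c' where "P = [:c, c':]" "c' \<noteq> 0" by (metis One_nat_def degree1_coeffs)
  then show ?thesis using surj by (intro that[of c' c]) (auto simp: algebra_simps)
qed

section \<open>The topology of the space of classes\<close>

definition point_class :: "nat \<Rightarrow> (nat \<Rightarrow> 'k::comm_semiring_0) \<Rightarrow> 'k set set" where
  "point_class n x = poly_class (x ` {1..n})"

lemma point_class_image: "point_class n ` distinct_points n = Sigma_classes n"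
  using image_distinct_points[of n, where 'a = 'a]
  unfolding point_class_def Sigma_classes_def by (metis image_image)

lemma distinct_points_nsubsets: "x \<in> distinct_points n \<Longrightarrow> x ` {1..n} \<in> nsubsets n"
  using image_distinct_points by blast

lemma quotient_map_point_class:
  "quotient_map (subtopology (zariski n) (distinct_points n)) (Sigma_space n)
     (point_class n :: (nat \<Rightarrow> 'k::idom) \<Rightarrow> 'k set set)"
proof -
  have "point_class n = poly_class \<circ> (\<lambda>x :: nat \<Rightarrow> 'k. x ` {1..n})"
    by (auto simp: point_class_def)
  then show ?thesis
    unfolding Sigma_space_def nsubset_space_def
    using quotient_map_compose[OF quotient_map_quotient_topology quotient_map_quotient_topology]
    by metis
qed

text \<open>The two successive quotients amount to one quotient map from the points with distinct
  coordinates, so a set of classes is closed iff its preimage is cut out by polynomials.\<close>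

lemma closedin_Sigma_space:
  fixes T :: "'k::idom set set set"
  shows "closedin (Sigma_space n) T \<longleftrightarrow> T \<subseteq> Sigma_classes n \<and>
    (\<exists>S\<subseteq>mpolys n. {x \<in> distinct_points n. point_class n x \<in> T} = zero_locus n S \<inter> distinct_points n)"
proof -
  have top: "topspace (subtopology (zariski n) (distinct_points n)) = (distinct_points n :: (nat \<Rightarrow> 'k) set)"
    by (auto simp: distinct_points_def)
  have "closedin (Sigma_space n) T \<longleftrightarrow> closedin (subtopology (zariski n) (distinct_points n))
      {x \<in> distinct_points n. point_class n x \<in> T}" if "T \<subseteq> Sigma_classes n"
    using quotient_map_point_class[of n, where 'k = 'k] that
    unfolding quotient_map_closedin top topspace_Sigma_space by simp
  moreover have "closedin (Sigma_space n) T \<Longrightarrow> T \<subseteq> Sigma_classes n"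
    by (metis closedin_subset topspace_Sigma_space)
  ultimately show ?thesis
    unfolding closedin_subtopology closedin_zariski by blast
qed

text \<open>The fibres of \<open>point_class\<close> are the orbits of \<open>Sym\<^sub>n\<close> and of the affine group together.\<close>

lemma point_class_eq_affine:
  fixes x y :: "nat \<Rightarrow> 'k::{alg_closed_field, field_char_0}"
  assumes n: "n \<ge> 2" and x: "x \<in> distinct_points n" and y: "y \<in> distinct_points n"
    and eq: "point_class n x = point_class n y"
  obtains a b \<tau> where "a \<noteq> 0" "\<tau> permutes {1..n}" "\<And>i. i \<in> {1..n} \<Longrightarrow> y i = a * x (\<tau> i) + b"
proof -
  obtain a b where a: "a \<noteq> 0" and im: "y ` {1..n} = (\<lambda>t. a * t + b) ` (x ` {1..n})"
    using poly_class_eq_imp_affine_image distinct_points_nsubsets[OF x] distinct_points_nsubsets[OF y] n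
      eq[unfolded point_class_def] by metis
  have "bij_betw y {1..n} (y ` {1..n})"
    using y by (auto simp: distinct_points_def bij_betw_def)
  moreover have "inj_on (\<lambda>i. a * x i + b) {1..n}"
    using x a inj_on_eq_iff[of x "{1..n}"] by (intro inj_onI) (simp add: distinct_points_def)
  then have bij: "bij_betw (\<lambda>i. a * x i + b) {1..n} (y ` {1..n})"
    unfolding im image_image by (simp add: bij_betw_def)
  ultimately have "bij_betw (inv_into {1..n} (\<lambda>i. a * x i + b) \<circ> y) {1..n} {1..n}"
    using bij_betw_inv_into bij_betw_trans by blast
  moreover define \<tau> where
    "\<tau> i = (if i \<in> {1..n} then inv_into {1..n} (\<lambda>i. a * x i + b) (y i) else i)" for i
  ultimately have "bij_betw \<tau> {1..n} {1..n}"
    using bij_betw_cong[of "{1..n}" \<tau> "inv_into {1..n} (\<lambda>i. a * x i + b) \<circ> y"] by (simp add: \<tau>_def)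
  then have "\<tau> permutes {1..n}" by (rule bij_imp_permutes) (auto simp: \<tau>_def)
  moreover have "y i = a * x (\<tau> i) + b" if "i \<in> {1..n}" for i
    using bij_betw_inv_into_right[OF bij, of "y i"] that by (simp add: \<tau>_def)
  ultimately show ?thesis using that a by blast
qed

section \<open>Regular functions separate closed sets from points\<close>

text \<open>The quotients of polynomials whose denominators vanish nowhere on \<open>D(f\<^sub>n)\<close>. A function \<open>h\<close> on
  classes is a regular function on the quotient when its pullback \<open>\<lambda>x. h (point_class n x)\<close> is regular.\<close>

definition regular :: "nat \<Rightarrow> ((nat \<Rightarrow> 'k::comm_ring_1) \<Rightarrow> 'k) \<Rightarrow> bool" where
  "regular n h \<longleftrightarrow> (\<exists>p q. poly_function n p \<and> poly_function n q \<and>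
     (\<forall>x\<in>distinct_points n. q x \<noteq> 0 \<and> h x * q x = p x))"

lemma regular_cong:
  assumes "\<And>x. x \<in> distinct_points n \<Longrightarrow> h x = h' x"
  shows "regular n h \<longleftrightarrow> regular n h'"
  unfolding regular_def using assms by (metis (no_types, lifting))

lemma regular_poly_function: "poly_function n h \<Longrightarrow> regular n h"
  unfolding regular_def by (intro exI[of _ h] exI[of _ "\<lambda>x. 1"]) auto

lemma regular_add [intro]:
  fixes f g :: "(nat \<Rightarrow> 'k::idom) \<Rightarrow> 'k"
  assumes "regular n f" "regular n g"
  shows "regular n (\<lambda>x. f x + g x)"
proof -
  obtain p q p' q' where "poly_function n p" "poly_function n q" "poly_function n p'" "poly_function n q'"
    and *: "\<And>x. x \<in> distinct_points n \<Longrightarrow> q x \<noteq> 0 \<and> f x * q x = p x \<and> q' x \<noteq> 0 \<and> g x * q' x = p' x"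
    using assms unfolding regular_def by metis
  moreover have "q x * q' x \<noteq> 0 \<and> (f x + g x) * (q x * q' x) = p x * q' x + p' x * q x"
    if "x \<in> distinct_points n" for x
  proof -
    have "(f x + g x) * (q x * q' x) = (f x * q x) * q' x + (g x * q' x) * q x"
      by (simp add: algebra_simps)
    then show ?thesis using *[OF that] by simp
  qed
  ultimately show ?thesis
    unfolding regular_def
    by (intro exI[of _ "\<lambda>x. p x * q' x + p' x * q x"] exI[of _ "\<lambda>x. q x * q' x"]) auto
qed

lemma regular_mult [intro]:
  fixes f g :: "(nat \<Rightarrow> 'k::idom) \<Rightarrow> 'k"
  assumes "regular n f" "regular n g"
  shows "regular n (\<lambda>x. f x * g x)"
proof -
  obtain p q p' q' where "poly_function n p" "poly_function n q" "poly_function n p'" "poly_function n q'"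
    and *: "\<And>x. x \<in> distinct_points n \<Longrightarrow> q x \<noteq> 0 \<and> f x * q x = p x \<and> q' x \<noteq> 0 \<and> g x * q' x = p' x"
    using assms unfolding regular_def by metis
  moreover have "q x * q' x \<noteq> 0 \<and> (f x * g x) * (q x * q' x) = p x * p' x"
    if "x \<in> distinct_points n" for x
  proof -
    have "(f x * g x) * (q x * q' x) = (f x * q x) * (g x * q' x)"
      by (simp add: algebra_simps)
    then show ?thesis using *[OF that] by simp
  qed
  ultimately show ?thesis
    unfolding regular_def
    by (intro exI[of _ "\<lambda>x. p x * p' x"] exI[of _ "\<lambda>x. q x * q' x"]) auto
qed

lemma regular_const [intro]: "regular n (\<lambda>x. c)"
  by (intro regular_poly_function poly_function_const)

lemma regular_diff:
  fixes f g :: "(nat \<Rightarrow> 'k::idom) \<Rightarrow> 'k"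
  assumes "regular n f" "regular n g"
  shows "regular n (\<lambda>x. f x - g x)"
  using regular_add[OF assms(1) regular_mult[OF regular_const[of n "-1"] assms(2)]] by simp

lemma regular_prod:
  fixes f :: "'i \<Rightarrow> (nat \<Rightarrow> 'k::idom) \<Rightarrow> 'k"
  shows "(\<And>i. i \<in> I \<Longrightarrow> regular n (f i)) \<Longrightarrow> regular n (\<lambda>x. \<Prod>i\<in>I. f i x)"
  by (induction I rule: infinite_finite_induct) auto

lemma regular_ratio:
  fixes n :: nat
  assumes "i \<in> {1..n}" "i' \<in> {1..n}" "j \<in> {1..n}" "j' \<in> {1..n}" "j \<noteq> j'"
  shows "regular n (\<lambda>x :: nat \<Rightarrow> 'k::field. (x i - x i') / (x j - x j'))"
proof -
  have "x j \<noteq> x j'" if "x \<in> distinct_points n" for x :: "nat \<Rightarrow> 'k"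
    using that assms(3-5) inj_on_eq_iff[of x "{1..n}" j j'] by (simp add: distinct_points_def)
  then show ?thesis
    unfolding regular_def
    by (intro exI[of _ "\<lambda>x. x i - x i'"] exI[of _ "\<lambda>x. x j - x j'"])
      (simp add: poly_function_diff poly_function_coord assms(1-4)[simplified])
qed

lemma closedin_regular_zeros:
  fixes h :: "'k::idom set set \<Rightarrow> 'k"
  assumes "regular n (\<lambda>x. h (point_class n x))"
  shows "closedin (Sigma_space n) {s \<in> Sigma_classes n. h s = 0}"
proof -
  obtain p q where p: "p \<in> mpolys n"
    and *: "\<And>x. x \<in> distinct_points n \<Longrightarrow> q x \<noteq> 0 \<and> h (point_class n x) * q x = mpoly_eval p x"
    using assms unfolding regular_def poly_function_def by metis
  have "h (point_class n x) = 0 \<longleftrightarrow> mpoly_eval p x = 0" if "x \<in> distinct_points n" for x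
    using *[OF that] by (metis mult_eq_0_iff)
  moreover have "x \<in> affine_space n" if "x \<in> distinct_points n" for x :: "nat \<Rightarrow> 'k"
    using that by (simp add: distinct_points_def)
  ultimately have "{x \<in> distinct_points n. point_class n x \<in> {s \<in> Sigma_classes n. h s = 0}} =
      zero_locus n {p} \<inter> distinct_points n"
    using point_class_image[of n, where 'a = 'k] by (auto simp: zero_locus_def)
  with p show ?thesis
    unfolding closedin_Sigma_space by blast
qed

text \<open>The representative \<open>y\<close> of the affine orbit of \<open>x \<circ> \<sigma>\<close> with \<open>y\<^sub>1 = 0\<close> and \<open>y\<^sub>2 = 1\<close>. Functions of it
  are invariant under affine maps.\<close>

definition normalized :: "nat \<Rightarrow> (nat \<Rightarrow> nat) \<Rightarrow> (nat \<Rightarrow> 'k::field) \<Rightarrow> nat \<Rightarrow> 'k" where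
  "normalized n \<sigma> x = (\<lambda>i\<in>{1..n}. (x (\<sigma> i) - x (\<sigma> 1)) / (x (\<sigma> 2) - x (\<sigma> 1)))"

lemma normalized_point:
  fixes x :: "nat \<Rightarrow> 'k::field"
  assumes n: "n \<ge> 2" and x: "x \<in> distinct_points n" and \<sigma>: "\<sigma> permutes {1..n}"
  shows "normalized n \<sigma> x \<in> distinct_points n"
    and "point_class n (normalized n \<sigma> x) = point_class n x"
proof -
  have inj: "inj_on x {1..n}" using x by (simp add: distinct_points_def)
  have "\<sigma> 2 \<noteq> \<sigma> 1" using permutes_inj[OF \<sigma>] by (simp add: inj_eq)
  moreover have "\<sigma> 2 \<in> {1..n}" "\<sigma> 1 \<in> {1..n}" using permutes_in_image[OF \<sigma>] n by auto
  ultimately have d: "x (\<sigma> 2) - x (\<sigma> 1) \<noteq> 0" using inj_on_eq_iff[OF inj] by simp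
  define a b where "a = 1 / (x (\<sigma> 2) - x (\<sigma> 1))" and "b = - x (\<sigma> 1) / (x (\<sigma> 2) - x (\<sigma> 1))"
  have a: "a \<noteq> 0" using d by (simp add: a_def)
  have eq: "normalized n \<sigma> x i = a * x (\<sigma> i) + b" if "i \<in> {1..n}" for i
    using that by (simp add: normalized_def a_def b_def diff_divide_distrib)
  have "inj_on (normalized n \<sigma> x) {1..n}"
  proof (rule inj_onI)
    fix i j assume ij: "i \<in> {1..n}" "j \<in> {1..n}" "normalized n \<sigma> x i = normalized n \<sigma> x j"
    then have "x (\<sigma> i) = x (\<sigma> j)" using a by (simp add: eq)
    then have "\<sigma> i = \<sigma> j" using inj ij(1,2) permutes_in_image[OF \<sigma>] by (metis inj_onD)
    then show "i = j" using permutes_inj[OF \<sigma>] by (simp add: inj_eq)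
  qed
  then show "normalized n \<sigma> x \<in> distinct_points n"
    by (simp add: distinct_points_def affine_space_def normalized_def)
  have "normalized n \<sigma> x ` {1..n} = (\<lambda>t. a * t + b) ` (x ` (\<sigma> ` {1..n}))"
    using eq unfolding image_image by (intro image_cong refl)
  also have "\<dots> = (\<lambda>t. a * t + b) ` (x ` {1..n})"
    using permutes_image[OF \<sigma>] by simp
  finally show "point_class n (normalized n \<sigma> x) = point_class n x"
    unfolding point_class_def using poly_class_affine_image[OF a] by simp
qed

lemma normalized_affine:
  assumes a: "a \<noteq> (0::'k::field)" and n: "n \<ge> 2" and \<tau>: "\<tau> permutes {1..n}" and \<sigma>: "\<sigma> permutes {1..n}"
    and y: "\<And>i. i \<in> {1..n} \<Longrightarrow> y i = a * x (\<tau> i) + b"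
  shows "normalized n \<sigma> y = normalized n (\<tau> \<circ> \<sigma>) x"
proof
  fix i
  have im: "\<sigma> j \<in> {1..n}" if "j \<in> {1..n}" for j using that permutes_in_image[OF \<sigma>, of j] by blast
  have one: "1 \<in> {1..n}" and two: "2 \<in> {1..n}" using n by auto
  have "normalized n \<sigma> y i = normalized n (\<tau> \<circ> \<sigma>) x i" if i: "i \<in> {1..n}"
  proof -
    have d: "y (\<sigma> i) - y (\<sigma> 1) = a * (x (\<tau> (\<sigma> i)) - x (\<tau> (\<sigma> 1)))"
      "y (\<sigma> 2) - y (\<sigma> 1) = a * (x (\<tau> (\<sigma> 2)) - x (\<tau> (\<sigma> 1)))"
      unfolding y[OF im[OF i]] y[OF im[OF one]] y[OF im[OF two]] by (simp_all add: right_diff_distrib)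
    show ?thesis
      by (simp only: normalized_def restrict_apply i if_True o_apply d mult_divide_mult_cancel_left[OF a])
  qed
  moreover have "normalized n \<sigma> y i = normalized n (\<tau> \<circ> \<sigma>) x i" if "i \<notin> {1..n}"
    by (simp only: normalized_def restrict_apply that if_False)
  ultimately show "normalized n \<sigma> y i = normalized n (\<tau> \<circ> \<sigma>) x i" by blast
qed

lemma regular_normalized:
  fixes p :: "(nat \<Rightarrow>\<^sub>0 nat) \<Rightarrow>\<^sub>0 'k::field"
  assumes "n \<ge> 2" and p: "p \<in> mpolys n" and \<sigma>: "\<sigma> permutes {1..n}"
  shows "regular n (\<lambda>x. mpoly_eval p (normalized n \<sigma> x))"
proof (rule mpoly_eval_closure[where Q = "regular n" and c = "normalized n \<sigma>", OF _ _ _ _ p])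
  fix i assume i: "i \<in> {1..n}"
  have im: "\<sigma> j \<in> {1..n}" if "j \<in> {1..n}" for j using that permutes_in_image[OF \<sigma>, of j] by blast
  have "\<sigma> 2 \<noteq> \<sigma> 1" using permutes_inj[OF \<sigma>] by (simp add: inj_eq)
  moreover have "1 \<in> {1..n}" "2 \<in> {1..n}" using assms(1) by auto
  ultimately have "regular n (\<lambda>x :: nat \<Rightarrow> 'k. (x (\<sigma> i) - x (\<sigma> 1)) / (x (\<sigma> 2) - x (\<sigma> 1)))"
    by (intro regular_ratio im i)
  then show "regular n (\<lambda>x :: nat \<Rightarrow> 'k. normalized n \<sigma> x i)"
    by (simp only: normalized_def restrict_apply i if_True)
next
  show "regular n (\<lambda>x. c)" for c :: 'k by (rule regular_const)
  show "regular n (\<lambda>x. f x + g x)" if "regular n f" "regular n g" for f g :: "(nat \<Rightarrow> 'k) \<Rightarrow> 'k"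
    using that by (rule regular_add)
  show "regular n (\<lambda>x. f x * g x)" if "regular n f" "regular n g" for f g :: "(nat \<Rightarrow> 'k) \<Rightarrow> 'k"
    using that by (rule regular_mult)
qed

text \<open>Start from a polynomial \<open>p\<close> that vanishes on the preimage of \<open>C\<close> but not at the normalized
  representative of \<open>s\<close>, where it has the value \<open>l \<noteq> 0\<close>. Composed with all the normalizations, it gives
  the functions \<open>p\<^sub>\<sigma>\<close>, and \<open>(\<Prod>\<^sub>\<sigma> (l - p\<^sub>\<sigma>)) - l\<^sup>N\<close> with \<open>N = n!\<close> is invariant. On \<open>C\<close> all \<open>p\<^sub>\<sigma>\<close> are \<open>0\<close>
  and the two terms cancel; at \<open>s\<close> one factor of the product is \<open>0\<close>, which leaves \<open>- l\<^sup>N \<noteq> 0\<close>.\<close>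

theorem regular_separation:
  fixes C :: "'k::{alg_closed_field, field_char_0} set set set"
  assumes n: "n \<ge> 2" and C: "closedin (Sigma_space n) C" and s: "s \<in> Sigma_classes n" "s \<notin> C"
  obtains h where "regular n (\<lambda>x. h (point_class n x))" "\<And>t. t \<in> C \<Longrightarrow> h t = 0" "h s \<noteq> (0 :: 'k)"
proof -
  obtain x0 where x0: "x0 \<in> distinct_points n" "point_class n x0 = s"
    using s(1) unfolding point_class_image[symmetric] by blast
  obtain S where S: "S \<subseteq> mpolys n"
    "{x \<in> distinct_points n. point_class n x \<in> C} = zero_locus n S \<inter> distinct_points n"
    using C unfolding closedin_Sigma_space by blast
  let ?P = "{\<sigma>. \<sigma> permutes {1..n}}"
  have id: "id permutes {1..n}" by (rule permutes_id)
  note norm0 = normalized_point[OF n x0(1) id]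
  have "normalized n id x0 \<notin> zero_locus n S"
    using norm0 S(2) s(2) x0(2) by (metis (mono_tags, lifting) Int_iff mem_Collect_eq)
  moreover have "normalized n id x0 \<in> affine_space n"
    using norm0(1) by (simp add: distinct_points_def)
  ultimately obtain p where p: "p \<in> S" "mpoly_eval p (normalized n id x0) \<noteq> 0"
    unfolding zero_locus_def by blast
  define l where "l = mpoly_eval p (normalized n id x0)"
  define H where "H x = (\<Prod>\<sigma>\<in>?P. l - mpoly_eval p (normalized n \<sigma> x)) - l ^ card ?P" for x
  define h where "h t = H (SOME x. x \<in> distinct_points n \<and> point_class n x = t)" for t
  have H_inv: "H x = H y"
    if x: "x \<in> distinct_points n" and y: "y \<in> distinct_points n" and xy: "point_class n x = point_class n y" for x y
  proof -
    obtain a b \<tau> where a: "a \<noteq> 0" and \<tau>: "\<tau> permutes {1..n}" and yx: "\<And>i. i \<in> {1..n} \<Longrightarrow> y i = a * x (\<tau> i) + b"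
      using point_class_eq_affine[OF n x y xy] by metis
    have "bij_betw (\<lambda>\<sigma>. \<tau> \<circ> \<sigma>) ?P ?P"
      by (rule bij_betw_byWitness[where f' = "\<lambda>\<sigma>. inv \<tau> \<circ> \<sigma>"])
        (auto simp: o_assoc permutes_inv_o[OF \<tau>] simp del: One_nat_def intro!: permutes_compose \<tau> permutes_inv)
    then have "(\<Prod>\<sigma>\<in>?P. l - mpoly_eval p (normalized n (\<tau> \<circ> \<sigma>) x)) =
        (\<Prod>\<sigma>\<in>?P. l - mpoly_eval p (normalized n \<sigma> x))"
      by (rule prod.reindex_bij_betw)
    moreover have "(\<Prod>\<sigma>\<in>?P. l - mpoly_eval p (normalized n \<sigma> y)) =
        (\<Prod>\<sigma>\<in>?P. l - mpoly_eval p (normalized n (\<tau> \<circ> \<sigma>) x))"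
    proof (rule prod.cong)
      fix \<sigma> assume "\<sigma> \<in> ?P"
      then have "\<sigma> permutes {1..n}" by simp
      from normalized_affine[where y = y and x = x and b = b, OF a n \<tau> this yx]
      show "l - mpoly_eval p (normalized n \<sigma> y) = l - mpoly_eval p (normalized n (\<tau> \<circ> \<sigma>) x)"
        by metis
    qed simp
    ultimately show ?thesis by (simp add: H_def)
  qed
  have h: "h (point_class n x) = H x" if "x \<in> distinct_points n" for x
  proof -
    define y where "y = (SOME y. y \<in> distinct_points n \<and> point_class n y = point_class n x)"
    have "y \<in> distinct_points n \<and> point_class n y = point_class n x"
      unfolding y_def by (rule someI[of _ x]) (use that in simp)
    then show ?thesis using H_inv[of y x] that by (simp add: h_def y_def)
  qed
  have "regular n H"
    unfolding H_def using S(1) p(1)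
    by (intro regular_diff regular_prod regular_const regular_normalized n) auto
  then have "regular n (\<lambda>x. h (point_class n x))"
    using regular_cong[of n "\<lambda>x. h (point_class n x)" H] h by simp
  moreover have "h t = 0" if t: "t \<in> C" for t
  proof -
    have "t \<in> Sigma_classes n" using t C unfolding closedin_Sigma_space by blast
    then obtain x where x: "x \<in> distinct_points n" "point_class n x = t"
      unfolding point_class_image[symmetric] by blast
    have "mpoly_eval p (normalized n \<sigma> x) = 0" if \<sigma>: "\<sigma> \<in> ?P" for \<sigma>
    proof -
      have "normalized n \<sigma> x \<in> {x \<in> distinct_points n. point_class n x \<in> C}"
        using normalized_point[OF n x(1), of \<sigma>] \<sigma> x(2) t by simp
      then show ?thesis unfolding S(2) zero_locus_def using p(1) by blast
    qed
    then have "H x = 0" by (simp add: H_def)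
    then show ?thesis using h[OF x(1)] x(2) by simp
  qed
  moreover have "h s \<noteq> 0"
  proof -
    have "(\<Prod>\<sigma>\<in>?P. l - mpoly_eval p (normalized n \<sigma> x0)) = 0"
      using id by (intro prod_zero bexI[of _ id]) (simp_all add: finite_permutations l_def del: One_nat_def)
    then show ?thesis using h[OF x0(1)] x0(2) p(2) by (simp add: H_def l_def)
  qed
  ultimately show ?thesis by (rule that)
qed

section \<open>Algebraic independence along chains of irreducible closed sets\<close>

text \<open>A relation is recorded by its coefficients \<open>a \<alpha>\<close> on the exponents in the box \<open>{0, \<dots>, K - 1}\<^sup>r\<close>, which
  is the form produced by counting.\<close>

definition algebraically_dependent :: "nat \<Rightarrow> (nat \<Rightarrow> 'a \<Rightarrow> 'k::comm_ring_1) \<Rightarrow> 'a set \<Rightarrow> bool" where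
  "algebraically_dependent r f Z \<longleftrightarrow>
     (\<exists>K a. (\<exists>\<alpha>\<in>{..<r} \<rightarrow>\<^sub>E {..<K::nat}. a \<alpha> \<noteq> 0) \<and>
        (\<forall>z\<in>Z. (\<Sum>\<alpha>\<in>{..<r} \<rightarrow>\<^sub>E {..<K}. a \<alpha> * (\<Prod>i<r. f i z ^ \<alpha> i)) = 0))"

text \<open>A relation between \<open>f 0, \<dots>, f r\<close> on \<open>Z'\<close> is divided by the largest power of \<open>f r\<close> that occurs in
  all its terms; the hypothesis \<open>prime\<close>, which expresses the irreducibility of \<open>Z'\<close>, shows that the
  quotient is still a relation on \<open>Z'\<close>. Restricted to \<open>Z\<close>, where \<open>f r\<close> vanishes, only the terms without
  \<open>f r\<close> survive, and these give a nontrivial relation between \<open>f 0, \<dots>, f (r - 1)\<close>.\<close>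

lemma algebraically_independent_Suc:
  fixes f :: "nat \<Rightarrow> 'a \<Rightarrow> 'k::idom"
  assumes R_const: "\<And>c. R (\<lambda>z. c)"
    and R_add: "\<And>u v. R u \<Longrightarrow> R v \<Longrightarrow> R (\<lambda>z. u z + v z)"
    and R_mult: "\<And>u v. R u \<Longrightarrow> R v \<Longrightarrow> R (\<lambda>z. u z * v z)"
    and f: "\<And>i. i \<le> r \<Longrightarrow> R (f i)"
    and prime: "\<And>u v. R u \<Longrightarrow> R v \<Longrightarrow> \<forall>z\<in>Z'. u z * v z = 0 \<Longrightarrow> (\<forall>z\<in>Z'. u z = 0) \<or> (\<forall>z\<in>Z'. v z = 0)"
    and sub: "Z \<subseteq> Z'" and zero: "\<And>z. z \<in> Z \<Longrightarrow> f r z = 0" and nonzero: "\<exists>z\<in>Z'. f r z \<noteq> 0"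
    and indep: "\<not> algebraically_dependent r f Z"
  shows "\<not> algebraically_dependent (Suc r) f Z'"
proof
  have pow: "R (\<lambda>z. u z ^ e)" if "R u" for u :: "'a \<Rightarrow> 'k" and e
    by (induction e) (auto intro: R_const R_mult that)
  have prod: "R (\<lambda>z. \<Prod>i\<in>I. u i z)" if "\<And>i. i \<in> I \<Longrightarrow> R (u i)" for I :: "nat set" and u
    using that by (induction I rule: infinite_finite_induct) (auto intro: R_const R_mult)
  have sum: "R (\<lambda>z. \<Sum>i\<in>I. u i z)" if "\<And>i. i \<in> I \<Longrightarrow> R (u i)" for I :: "(nat \<Rightarrow> nat) set" and u
    using that by (induction I rule: infinite_finite_induct) (auto intro: R_const R_add)
  assume "algebraically_dependent (Suc r) f Z'"
  then obtain K a where ex: "\<exists>\<alpha>\<in>{..<Suc r} \<rightarrow>\<^sub>E {..<K}. a \<alpha> \<noteq> 0"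
    and rel: "\<And>z. z \<in> Z' \<Longrightarrow> (\<Sum>\<alpha>\<in>{..<Suc r} \<rightarrow>\<^sub>E {..<K}. a \<alpha> * (\<Prod>i<Suc r. f i z ^ \<alpha> i)) = 0"
    unfolding algebraically_dependent_def by blast
  define A where "A = ({..<Suc r} \<rightarrow>\<^sub>E {..<K})"
  define supp where "supp = {\<alpha> \<in> A. a \<alpha> \<noteq> 0}"
  have fin: "finite A" "finite supp" by (auto simp: A_def supp_def intro!: finite_PiE)
  \<comment> \<open>The exponent of the largest power of \<open>f r\<close> that divides every term of the relation.\<close>
  define j where "j = (LEAST j. \<exists>\<alpha>\<in>supp. \<alpha> r = j)"
  have "\<exists>j. \<exists>\<alpha>\<in>supp. \<alpha> r = j" using ex by (auto simp: supp_def A_def)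
  then have "\<exists>\<alpha>\<in>supp. \<alpha> r = j" unfolding j_def by (rule LeastI_ex)
  then obtain \<alpha>0 where \<alpha>0: "\<alpha>0 \<in> supp" "\<alpha>0 r = j" by blast
  have jle: "j \<le> \<alpha> r" if "\<alpha> \<in> supp" for \<alpha>
    unfolding j_def by (rule Least_le) (use that in blast)
  have jK: "j < K" using \<alpha>0 by (auto simp: supp_def A_def PiE_def Pi_def)
  define H where "H z = (\<Sum>\<alpha>\<in>supp. a \<alpha> * (\<Prod>i<r. f i z ^ \<alpha> i) * f r z ^ (\<alpha> r - j))" for z
  have "f r z ^ j * H z = 0" if "z \<in> Z'" for z
  proof -
    have "f r z ^ j * H z = (\<Sum>\<alpha>\<in>supp. a \<alpha> * (\<Prod>i<Suc r. f i z ^ \<alpha> i))"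
      unfolding H_def sum_distrib_left
    proof (rule sum.cong[OF refl])
      fix \<alpha> assume "\<alpha> \<in> supp"
      then have "f r z ^ \<alpha> r = f r z ^ j * f r z ^ (\<alpha> r - j)"
        using jle by (simp flip: power_add)
      then show "f r z ^ j * (a \<alpha> * (\<Prod>i<r. f i z ^ \<alpha> i) * f r z ^ (\<alpha> r - j)) =
          a \<alpha> * (\<Prod>i<Suc r. f i z ^ \<alpha> i)" by simp
    qed
    also have "\<dots> = (\<Sum>\<alpha>\<in>A. a \<alpha> * (\<Prod>i<Suc r. f i z ^ \<alpha> i))"
      by (rule sum.mono_neutral_left) (auto simp: fin supp_def)
    finally show ?thesis using rel[OF that] by (simp add: A_def)
  qed
  moreover have "R (\<lambda>z. f r z ^ j)" by (intro pow f order_refl)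
  moreover have "R H" unfolding H_def by (intro sum R_mult R_const prod pow f) auto
  ultimately have "(\<forall>z\<in>Z'. f r z ^ j = 0) \<or> (\<forall>z\<in>Z'. H z = 0)"
    using prime[of "\<lambda>z. f r z ^ j" H] by blast
  moreover obtain z0 where "z0 \<in> Z'" "f r z0 \<noteq> 0" using nonzero by blast
  ultimately have H0: "H z = 0" if "z \<in> Z" for z using that sub by (meson power_not_zero subsetD)
  have "(\<Sum>\<beta>\<in>{..<r} \<rightarrow>\<^sub>E {..<K}. a (\<beta>(r := j)) * (\<Prod>i<r. f i z ^ \<beta> i)) = 0" if z: "z \<in> Z" for z
  proof -
    have "H z = (\<Sum>\<alpha>\<in>supp. if \<alpha> r = j then a \<alpha> * (\<Prod>i<r. f i z ^ \<alpha> i) else 0)"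
      unfolding H_def
      by (rule sum.cong[OF refl]) (use jle zero[OF z] in \<open>auto simp: zero_power dest: le_neq_implies_less\<close>)
    also have "\<dots> = (\<Sum>\<alpha>\<in>A. if \<alpha> r = j then a \<alpha> * (\<Prod>i<r. f i z ^ \<alpha> i) else 0)"
      by (rule sum.mono_neutral_left) (auto simp: fin supp_def)
    also have "\<dots> = (\<Sum>\<alpha>\<in>{\<alpha>\<in>A. \<alpha> r = j}. a \<alpha> * (\<Prod>i<r. f i z ^ \<alpha> i))"
      by (rule sum.inter_filter[symmetric, OF fin(1)])
    also have "\<dots> = (\<Sum>\<beta>\<in>{..<r} \<rightarrow>\<^sub>E {..<K}. a (\<beta>(r := j)) * (\<Prod>i<r. f i z ^ \<beta> i))"
    proof (rule sum.reindex_bij_witness[where i = "\<lambda>\<beta>. \<beta>(r := j)" and j = "\<lambda>\<alpha>. restrict \<alpha> {..<r}"])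
      fix \<alpha> assume \<alpha>: "\<alpha> \<in> {\<alpha> \<in> A. \<alpha> r = j}"
      then show eq: "(restrict \<alpha> {..<r})(r := j) = \<alpha>"
        by (auto simp: A_def fun_eq_iff PiE_def extensional_def)
      show "restrict \<alpha> {..<r} \<in> {..<r} \<rightarrow>\<^sub>E {..<K}"
        using \<alpha> by (auto simp: A_def PiE_def Pi_def)
      show "a ((restrict \<alpha> {..<r})(r := j)) * (\<Prod>i<r. f i z ^ (restrict \<alpha> {..<r}) i) = a \<alpha> * (\<Prod>i<r. f i z ^ \<alpha> i)"
        unfolding eq by simp
    next
      fix \<beta> assume \<beta>: "\<beta> \<in> {..<r} \<rightarrow>\<^sub>E {..<K}"
      then show "restrict (\<beta>(r := j)) {..<r} = \<beta>"
        by (auto simp: fun_eq_iff PiE_def extensional_def)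
      show "\<beta>(r := j) \<in> {\<alpha> \<in> A. \<alpha> r = j}"
        using \<beta> jK by (auto simp: A_def PiE_def Pi_def extensional_def less_Suc_eq)
    qed
    finally show ?thesis using H0[OF z] by simp
  qed
  moreover have "a ((restrict \<alpha>0 {..<r})(r := j)) \<noteq> 0"
  proof -
    have "(restrict \<alpha>0 {..<r})(r := j) = \<alpha>0"
      using \<alpha>0 by (auto simp: supp_def A_def fun_eq_iff PiE_def extensional_def)
    then show ?thesis using \<alpha>0(1) by (simp add: supp_def)
  qed
  moreover have "restrict \<alpha>0 {..<r} \<in> {..<r} \<rightarrow>\<^sub>E {..<K}"
    using \<alpha>0(1) by (auto simp: supp_def A_def PiE_def Pi_def)
  ultimately have "algebraically_dependent r f Z"
    unfolding algebraically_dependent_def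
    by (intro exI[of _ K] exI[of _ "\<lambda>\<beta>. a (\<beta>(r := j))"] conjI ballI) (rule bexI)
  then show False using indep by contradiction
qed

lemma irreducible_zero_product:
  fixes u v :: "'a \<Rightarrow> 'k::idom"
  assumes irr: "irreducible_space (subtopology X Z)" and Z: "Z \<subseteq> topspace X"
    and u: "closedin X {z \<in> topspace X. u z = 0}" and v: "closedin X {z \<in> topspace X. v z = 0}"
    and uv: "\<forall>z\<in>Z. u z * v z = 0"
  shows "(\<forall>z\<in>Z. u z = 0) \<or> (\<forall>z\<in>Z. v z = 0)"
proof -
  have top: "topspace (subtopology X Z) = Z" using Z by auto
  let ?C = "{z \<in> topspace X. u z = 0} \<inter> Z" and ?D = "{z \<in> topspace X. v z = 0} \<inter> Z"
  have "closedin (subtopology X Z) ?C" "closedin (subtopology X Z) ?D"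
    using u v unfolding closedin_subtopology by blast+
  moreover have "Z = ?C \<union> ?D" using uv Z by auto
  ultimately have "?C = Z \<or> ?D = Z" using irr unfolding irreducible_space_def top by blast
  then show ?thesis by blast
qed

text \<open>Here \<open>R\<close> plays the role of the ring of regular functions on \<open>X\<close>. Each step of the chain adds one
  independent function. For \<open>m = 0\<close> the claim says that a
  nonzero constant is not zero on \<open>Z 0\<close>, which holds since irreducible spaces are nonempty.\<close>

theorem chain_algebraically_independent:
  fixes g :: "nat \<Rightarrow> 'a \<Rightarrow> 'k::idom"
  assumes R_const: "\<And>c. R (\<lambda>z. c)"
    and R_add: "\<And>u v. R u \<Longrightarrow> R v \<Longrightarrow> R (\<lambda>z. u z + v z)"
    and R_mult: "\<And>u v. R u \<Longrightarrow> R v \<Longrightarrow> R (\<lambda>z. u z * v z)"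
    and closed: "\<And>u. R u \<Longrightarrow> closedin X {z \<in> topspace X. u z = 0}"
    and irr: "\<And>i. i \<le> m \<Longrightarrow> closedin X (Z i) \<and> irreducible_space (subtopology X (Z i))"
    and chain: "\<And>i. i < m \<Longrightarrow> Z i \<subseteq> Z (Suc i)"
    and g: "\<And>i. i < m \<Longrightarrow> R (g i)" "\<And>i z. i < m \<Longrightarrow> z \<in> Z i \<Longrightarrow> g i z = 0"
      "\<And>i. i < m \<Longrightarrow> \<exists>z\<in>Z (Suc i). g i z \<noteq> 0"
  shows "\<not> algebraically_dependent m g (Z m)"
  using irr chain g
proof (induction m)
  case 0
  then have "irreducible_space (subtopology X (Z 0))" by blast
  then have "Z 0 \<noteq> {}" unfolding irreducible_space_def by auto
  then show ?case unfolding algebraically_dependent_def by auto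
next
  case (Suc m)
  have IH: "\<not> algebraically_dependent m g (Z m)"
    by (rule Suc.IH) (use Suc.prems in \<open>auto intro: less_SucI\<close>)
  have Z: "Z (Suc m) \<subseteq> topspace X" and Zirr: "irreducible_space (subtopology X (Z (Suc m)))"
    using Suc.prems(1)[of "Suc m"] closedin_subset by auto
  show ?case
  proof (rule algebraically_independent_Suc[of R, OF R_const])
    show "R (\<lambda>z. u z + v z)" "R (\<lambda>z. u z * v z)" if "R u" "R v" for u v
      using R_add[OF that] R_mult[OF that] .
    show "R (g i)" if "i \<le> m" for i using Suc.prems(3) that by simp
    show "(\<forall>z\<in>Z (Suc m). u z = 0) \<or> (\<forall>z\<in>Z (Suc m). v z = 0)"
      if "R u" "R v" "\<forall>z\<in>Z (Suc m). u z * v z = 0" for u v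
      by (rule irreducible_zero_product[OF Zirr Z closed closed]) (use that in auto)
    show "Z m \<subseteq> Z (Suc m)" using Suc.prems(2) by simp
    show "g m z = 0" if "z \<in> Z m" for z using Suc.prems(4) that by simp
    show "\<exists>z\<in>Z (Suc m). g m z \<noteq> 0" using Suc.prems(5) by simp
  qed (fact IH)
qed

section \<open>More functions than parameters are algebraically dependent\<close>

text \<open>Gaussian elimination: an equation that involves the unknown \<open>i0\<close> is used to eliminate it. The columns
  are indexed by \<open>I\<close> and need not be different, so this applies to monomials in functions that
  coincide.\<close>

lemma linear_system_nontrivial_solution:
  fixes m :: "'i \<Rightarrow> 'j \<Rightarrow> 'k::field"
  assumes "finite J" "finite I" "card J < card I"
  shows "\<exists>c. (\<exists>i\<in>I. c i \<noteq> 0) \<and> (\<forall>j\<in>J. (\<Sum>i\<in>I. c i * m i j) = 0)"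
  using assms
proof (induction J arbitrary: I m rule: finite_induct)
  case empty
  then have "I \<noteq> {}" by auto
  then show ?case by (intro exI[of _ "\<lambda>_. 1"]) auto
next
  case (insert j0 J)
  show ?case
  proof (cases "\<forall>i\<in>I. m i j0 = 0")
    case True
    have "card J < card I" using insert by simp
    then obtain c where c: "\<exists>i\<in>I. c i \<noteq> 0" "\<forall>j\<in>J. (\<Sum>i\<in>I. c i * m i j) = 0"
      using insert.IH[OF insert.prems(1), of m] by blast
    moreover have "(\<Sum>i\<in>I. c i * m i j0) = 0" using True by (intro sum.neutral) simp
    ultimately show ?thesis by (intro exI[of _ c]) simp
  next
    case False
    then obtain i0 where i0: "i0 \<in> I" "m i0 j0 \<noteq> 0" by blast
    define I' where "I' = I - {i0}"
    have I: "I = insert i0 I'" "i0 \<notin> I'" "finite I'" using i0 insert.prems by (auto simp: I'_def)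
    define m' where "m' i j = m i j - m i j0 / m i0 j0 * m i0 j" for i j
    have "card J < card I'" using insert.prems insert.hyps I by simp
    then obtain c where c: "\<exists>i\<in>I'. c i \<noteq> 0" and c0: "\<And>j. j \<in> J \<Longrightarrow> (\<Sum>i\<in>I'. c i * m' i j) = 0"
      using insert.IH[OF I(3), of m'] by blast
    define s where "s = (\<Sum>i\<in>I'. c i * (m i j0 / m i0 j0))"
    define c' where "c' i = (if i = i0 then - s else c i)" for i
    have expand: "(\<Sum>i\<in>I. c' i * m i j) = - s * m i0 j + (\<Sum>i\<in>I'. c i * m i j)" for j
    proof -
      have "(\<Sum>i\<in>I'. c' i * m i j) = (\<Sum>i\<in>I'. c i * m i j)"
        using I(2) by (intro sum.cong refl) (auto simp: c'_def)
      then show ?thesis using I by (simp add: c'_def)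
    qed
    have "s * m i0 j + (\<Sum>i\<in>I'. c i * m' i j) = (\<Sum>i\<in>I'. c i * m i j)" for j
      by (simp add: s_def m'_def sum_distrib_right right_diff_distrib sum_subtractf mult.assoc)
    from this[symmetric] have "(\<Sum>i\<in>I. c' i * m i j) = (\<Sum>i\<in>I'. c i * m' i j)" for j
      by (simp add: expand)
    moreover have "(\<Sum>i\<in>I'. c i * m' i j0) = 0"
      using i0(2) by (intro sum.neutral) (simp add: m'_def)
    ultimately have "\<forall>j\<in>insert j0 J. (\<Sum>i\<in>I. c' i * m i j) = 0" using c0 by simp
    moreover obtain i where "i \<in> I'" "c i \<noteq> 0" using c by blast
    then have "i \<in> I" "c' i \<noteq> 0" using I by (auto simp: c'_def)
    ultimately show ?thesis by blast
  qed
qed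

text \<open>The degrees in the \<open>d\<close> variables are bounded separately, so that the number of coefficients is
  the power \<open>(M + 1)\<^sup>d\<close>.\<close>

definition box_polynomial :: "nat \<Rightarrow> nat \<Rightarrow> ((nat \<Rightarrow> 'k::comm_ring_1) \<Rightarrow> 'k) \<Rightarrow> bool" where
  "box_polynomial d M F \<longleftrightarrow>
     (\<exists>c. \<forall>y. F y = (\<Sum>\<beta>\<in>{..<d} \<rightarrow>\<^sub>E {..M}. c \<beta> * (\<Prod>i<d. y i ^ \<beta> i)))"

lemma box_polynomial_monomial:
  assumes "\<beta> \<in> {..<d} \<rightarrow>\<^sub>E {..M}"
  shows "box_polynomial d M (\<lambda>y. c * (\<Prod>i<d. y i ^ \<beta> i))"
proof -
  have "(\<Sum>\<gamma>\<in>{..<d} \<rightarrow>\<^sub>E {..M}. (if \<gamma> = \<beta> then c else 0) * (\<Prod>i<d. y i ^ \<gamma> i)) =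
      (\<Sum>\<gamma>\<in>{..<d} \<rightarrow>\<^sub>E {..M}. if \<gamma> = \<beta> then c * (\<Prod>i<d. y i ^ \<beta> i) else 0)" for y
    by (intro sum.cong) auto
  also have "\<dots> y = c * (\<Prod>i<d. y i ^ \<beta> i)" for y
    using assms by (simp add: finite_PiE)
  finally show ?thesis
    unfolding box_polynomial_def by (intro exI[of _ "\<lambda>\<gamma>. if \<gamma> = \<beta> then c else 0"]) simp
qed

lemma box_polynomial_add:
  assumes "box_polynomial d M F" "box_polynomial d M G"
  shows "box_polynomial d M (\<lambda>y. F y + G y)"
proof -
  obtain b c where "\<And>y. F y = (\<Sum>\<beta>\<in>{..<d} \<rightarrow>\<^sub>E {..M}. b \<beta> * (\<Prod>i<d. y i ^ \<beta> i))"
    "\<And>y. G y = (\<Sum>\<beta>\<in>{..<d} \<rightarrow>\<^sub>E {..M}. c \<beta> * (\<Prod>i<d. y i ^ \<beta> i))"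
    using assms unfolding box_polynomial_def by blast
  then show ?thesis
    unfolding box_polynomial_def
    by (intro exI[of _ "\<lambda>\<beta>. b \<beta> + c \<beta>"]) (simp add: sum.distrib distrib_right)
qed

lemma box_polynomial_const: "box_polynomial d M (\<lambda>y. c)"
  using box_polynomial_monomial[of "\<lambda>i\<in>{..<d}. 0" d M c] by simp

lemma box_polynomial_sum:
  "(\<And>i. i \<in> I \<Longrightarrow> box_polynomial d M (F i)) \<Longrightarrow> box_polynomial d M (\<lambda>y. \<Sum>i\<in>I. F i y)"
  by (induction I rule: infinite_finite_induct) (auto intro: box_polynomial_const box_polynomial_add)

lemma box_polynomial_mono:
  assumes "box_polynomial d M F" "M \<le> N"
  shows "box_polynomial d N F"
proof -
  obtain c where c: "F = (\<lambda>y. \<Sum>\<beta>\<in>{..<d} \<rightarrow>\<^sub>E {..M}. c \<beta> * (\<Prod>i<d. y i ^ \<beta> i))"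
    using assms(1) unfolding box_polynomial_def by blast
  have "({..<d} \<rightarrow>\<^sub>E {..M}) \<subseteq> ({..<d} \<rightarrow>\<^sub>E {..N})"
    using assms(2) by (intro PiE_mono) auto
  then show ?thesis
    unfolding c by (intro box_polynomial_sum box_polynomial_monomial) blast
qed

lemma box_polynomial_mult:
  assumes "box_polynomial d M F" "box_polynomial d N G"
  shows "box_polynomial d (M + N) (\<lambda>y. F y * G y)"
proof -
  obtain b c where F: "F = (\<lambda>y. \<Sum>\<beta>\<in>{..<d} \<rightarrow>\<^sub>E {..M}. b \<beta> * (\<Prod>i<d. y i ^ \<beta> i))"
    and G: "G = (\<lambda>y. \<Sum>\<gamma>\<in>{..<d} \<rightarrow>\<^sub>E {..N}. c \<gamma> * (\<Prod>i<d. y i ^ \<gamma> i))"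
    using assms unfolding box_polynomial_def by blast
  have mono: "(\<lambda>y. (b \<beta> * (\<Prod>i<d. y i ^ \<beta> i)) * (c \<gamma> * (\<Prod>i<d. y i ^ \<gamma> i))) =
      (\<lambda>y. (b \<beta> * c \<gamma>) * (\<Prod>i<d. y i ^ (\<lambda>i\<in>{..<d}. \<beta> i + \<gamma> i) i))" for \<beta> \<gamma>
  proof
    fix y :: "nat \<Rightarrow> 'a"
    have "(\<Prod>i<d. y i ^ (\<lambda>i\<in>{..<d}. \<beta> i + \<gamma> i) i) = (\<Prod>i<d. y i ^ \<beta> i) * (\<Prod>i<d. y i ^ \<gamma> i)"
      unfolding prod.distrib[symmetric] by (intro prod.cong) (auto simp: power_add)
    then show "(b \<beta> * (\<Prod>i<d. y i ^ \<beta> i)) * (c \<gamma> * (\<Prod>i<d. y i ^ \<gamma> i)) =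
      (b \<beta> * c \<gamma>) * (\<Prod>i<d. y i ^ (\<lambda>i\<in>{..<d}. \<beta> i + \<gamma> i) i)" by (simp only: ac_simps)
  qed
  have "(\<lambda>i\<in>{..<d}. \<beta> i + \<gamma> i) \<in> {..<d} \<rightarrow>\<^sub>E {..M + N}"
    if "\<beta> \<in> {..<d} \<rightarrow>\<^sub>E {..M}" "\<gamma> \<in> {..<d} \<rightarrow>\<^sub>E {..N}" for \<beta> \<gamma>
    using that by (auto simp: PiE_def Pi_def intro: add_mono)
  then show ?thesis
    unfolding F G sum_product
    by (intro box_polynomial_sum) (simp only: mono box_polynomial_monomial)
qed

lemma box_polynomial_power:
  "box_polynomial d M F \<Longrightarrow> box_polynomial d (M * e) (\<lambda>y. F y ^ e)"
  by (induction e) (auto intro: box_polynomial_const box_polynomial_mult)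

lemma box_polynomial_prod:
  "(\<And>i. i < r \<Longrightarrow> box_polynomial d M (F i)) \<Longrightarrow> box_polynomial d (r * M) (\<lambda>y. \<Prod>i<r. F i y)"
proof (induction r)
  case (Suc r)
  then have "box_polynomial d (r * M + M) (\<lambda>y. (\<Prod>i<r. F i y) * F r y)"
    by (intro box_polynomial_mult) auto
  then show ?case by (simp add: add.commute)
qed (auto intro: box_polynomial_const)

lemma box_polynomial_coord: "i < d \<Longrightarrow> box_polynomial d 1 (\<lambda>y. y i)"
proof -
  assume i: "i < d"
  have "(\<lambda>j\<in>{..<d}. if j = i then 1 else 0) \<in> {..<d} \<rightarrow>\<^sub>E {..1::nat}" by auto
  from box_polynomial_monomial[OF this, of 1]
  have "box_polynomial d 1 (\<lambda>y :: nat \<Rightarrow> 'a. 1 * (\<Prod>j<d. y j ^ (\<lambda>j\<in>{..<d}. if j = i then 1 else 0) j))" .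
  moreover have "1 * (\<Prod>j<d. y j ^ (\<lambda>j\<in>{..<d}. if j = i then 1 else 0) j) = y i" for y :: "nat \<Rightarrow> 'a"
  proof -
    have "(\<Prod>j<d. y j ^ (\<lambda>j\<in>{..<d}. if j = i then 1 else 0) j) = (\<Prod>j<d. if j = i then y j else 1)"
      by (intro prod.cong) auto
    then show ?thesis using i by simp
  qed
  ultimately show ?thesis by (simp only:)
qed

text \<open>The left side grows like \<open>K\<^sup>d\<close>, the right side is \<open>K\<^bsup>d+1\<^esup>\<close>.\<close>

lemma counting_inequality:
  fixes w M d :: nat
  obtains K where "w * (Suc d * (M * K) + 1) ^ d < K ^ Suc d"
proof
  define C where "C = Suc d * M + 1"
  define K where "K = w * C ^ d + 1"
  have "Suc d * (M * K) + 1 \<le> C * K"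
    by (simp add: C_def algebra_simps) (simp add: K_def)
  then have "w * (Suc d * (M * K) + 1) ^ d \<le> w * (C * K) ^ d"
    by (intro mult_left_mono power_mono) auto
  also have "\<dots> = (w * C ^ d) * K ^ d" by (simp add: power_mult_distrib)
  also have "\<dots> < K * K ^ d" by (intro mult_strict_right_mono) (auto simp: K_def)
  finally show "w * (Suc d * (M * K) + 1) ^ d < K ^ Suc d" by simp
qed

text \<open>On the piece of \<open>Z\<close> that belongs to \<open>k \<in> Q\<close>, the functions \<open>f i\<close> are rational functions
  \<open>p k i / q k i\<close> of \<open>d\<close> parameters. Consider the \<open>K\<^bsup>d+1\<^esup>\<close> monomials in \<open>f 0, \<dots>, f d\<close> with exponents below
  \<open>K\<close>. Multiplied by the \<open>K\<close>-th powers of all the denominators, they become polynomials in the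
  parameters whose degrees are bounded linearly in \<open>K\<close>. That one combination of the monomials vanishes on
  all pieces is therefore a linear system with \<open>K\<^bsup>d+1\<^esup>\<close> unknowns and a number of equations of order
  \<open>K\<^sup>d\<close>.\<close>

theorem algebraically_dependent_by_counting:
  fixes f :: "nat \<Rightarrow> 'a \<Rightarrow> 'k::field"
  assumes Q: "finite Q"
    and poly: "\<And>k i. k \<in> Q \<Longrightarrow> i \<le> d \<Longrightarrow> \<exists>M. box_polynomial d M (p k i) \<and> box_polynomial d M (q k i)"
    and cover: "\<And>z. z \<in> Z \<Longrightarrow> \<exists>k\<in>Q. \<exists>y. \<forall>i\<le>d. q k i y \<noteq> 0 \<and> f i z * q k i y = p k i y"
  shows "algebraically_dependent (Suc d) f Z"
proof -
  obtain Mf where Mf: "\<And>k i. k \<in> Q \<Longrightarrow> i \<le> d \<Longrightarrow> box_polynomial d (Mf k i) (p k i) \<and> box_polynomial d (Mf k i) (q k i)"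
    using poly by metis
  \<comment> \<open>A common bound for the degrees of the finitely many numerators and denominators.\<close>
  define M where "M = (\<Sum>(k, i)\<in>Q \<times> {..d}. Mf k i)"
  have M: "box_polynomial d M (p k i)" "box_polynomial d M (q k i)" if "k \<in> Q" "i \<le> d" for k i
  proof -
    have "Mf k i \<le> M"
      unfolding M_def using member_le_sum[of "(k, i)" "Q \<times> {..d}" "\<lambda>(k, i). Mf k i"] Q that by auto
    then show "box_polynomial d M (p k i)" "box_polynomial d M (q k i)"
      using Mf[OF that] box_polynomial_mono by blast+
  qed
  obtain K where K: "card Q * (Suc d * (M * K) + 1) ^ d < K ^ Suc d"
    by (rule counting_inequality)
  define N where "N = Suc d * (M * K)"
  define F where "F k \<alpha> y = (\<Prod>i<Suc d. p k i y ^ \<alpha> i * q k i y ^ (K - \<alpha> i))" for k y and \<alpha> :: "nat \<Rightarrow> nat"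
  define I where "I = ({..<Suc d} \<rightarrow>\<^sub>E {..<K})"
  define B where "B = ({..<d} \<rightarrow>\<^sub>E {..N})"
  have "box_polynomial d N (F k \<alpha>)" if "k \<in> Q" "\<alpha> \<in> I" for k \<alpha>
    unfolding F_def N_def
  proof (rule box_polynomial_prod)
    fix i assume i: "i < Suc d"
    then have "\<alpha> i < K" using that(2) by (auto simp: I_def)
    then have MK: "M * K = M * \<alpha> i + M * (K - \<alpha> i)" by (simp flip: distrib_left)
    show "box_polynomial d (M * K) (\<lambda>y. p k i y ^ \<alpha> i * q k i y ^ (K - \<alpha> i))"
      unfolding MK by (intro box_polynomial_mult box_polynomial_power M that(1)) (use i in simp_all)
  qed
  then obtain c where c: "\<And>k \<alpha> y. k \<in> Q \<Longrightarrow> \<alpha> \<in> I \<Longrightarrow> F k \<alpha> y = (\<Sum>\<beta>\<in>B. c k \<alpha> \<beta> * (\<Prod>i<d. y i ^ \<beta> i))"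
    unfolding box_polynomial_def B_def by metis
  have fin: "finite I" "finite B" by (auto simp: I_def B_def intro!: finite_PiE)
  have "card I = K ^ Suc d" "card B = (N + 1) ^ d" by (simp_all add: I_def B_def card_PiE)
  then have "card (Q \<times> B) < card I" using K by (simp add: card_cartesian_product N_def)
  then obtain a where a: "\<exists>\<alpha>\<in>I. a \<alpha> \<noteq> 0"
    and a0: "\<And>k \<beta>. k \<in> Q \<Longrightarrow> \<beta> \<in> B \<Longrightarrow> (\<Sum>\<alpha>\<in>I. a \<alpha> * c k \<alpha> \<beta>) = 0"
    using linear_system_nontrivial_solution[of "Q \<times> B" I "\<lambda>\<alpha> (k, \<beta>). c k \<alpha> \<beta>"] Q fin by auto
  have "(\<Sum>\<alpha>\<in>I. a \<alpha> * (\<Prod>i<Suc d. f i z ^ \<alpha> i)) = 0" if z: "z \<in> Z" for z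
  proof -
    obtain k y where k: "k \<in> Q" and y: "\<And>i. i \<le> d \<Longrightarrow> q k i y \<noteq> 0 \<and> f i z * q k i y = p k i y"
      using cover[OF z] by blast
    have clear: "(\<Prod>i<Suc d. f i z ^ \<alpha> i) * (\<Prod>i<Suc d. q k i y ^ K) = F k \<alpha> y" if "\<alpha> \<in> I" for \<alpha>
      unfolding F_def prod.distrib[symmetric]
    proof (rule prod.cong[OF refl])
      fix i assume i: "i \<in> {..<Suc d}"
      then have "\<alpha> i < K" using that by (auto simp: I_def)
      then have "q k i y ^ K = q k i y ^ \<alpha> i * q k i y ^ (K - \<alpha> i)" by (simp flip: power_add)
      then show "f i z ^ \<alpha> i * q k i y ^ K = p k i y ^ \<alpha> i * q k i y ^ (K - \<alpha> i)"
        using y[of i] i by (simp add: power_mult_distrib flip: mult.assoc) (metis power_mult_distrib)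
    qed
    have "(\<Sum>\<alpha>\<in>I. a \<alpha> * (\<Prod>i<Suc d. f i z ^ \<alpha> i)) * (\<Prod>i<Suc d. q k i y ^ K) = (\<Sum>\<alpha>\<in>I. a \<alpha> * F k \<alpha> y)"
      unfolding sum_distrib_right by (intro sum.cong refl) (simp only: mult.assoc clear)
    also have "\<dots> = (\<Sum>\<alpha>\<in>I. \<Sum>\<beta>\<in>B. (a \<alpha> * c k \<alpha> \<beta>) * (\<Prod>i<d. y i ^ \<beta> i))"
      using c[OF k] by (intro sum.cong refl) (simp add: sum_distrib_left mult.assoc)
    also have "\<dots> = (\<Sum>\<beta>\<in>B. (\<Sum>\<alpha>\<in>I. a \<alpha> * c k \<alpha> \<beta>) * (\<Prod>i<d. y i ^ \<beta> i))"
      by (subst sum.swap) (simp add: sum_distrib_right)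
    also have "\<dots> = 0" using a0[OF k] by simp
    finally show ?thesis using y by (auto simp: less_Suc_eq_le)
  qed
  then show ?thesis
    unfolding algebraically_dependent_def using a unfolding I_def by blast
qed

section \<open>Parametrizing the exceptional classes\<close>

text \<open>The point \<open>(b\<^bsub>\<sigma>(1)\<^esub>, \<dots>, b\<^bsub>\<sigma>(n)\<^esub>)\<close> lies on the plane \<open>\<pi>\<^sub>\<sigma>\<close>. If \<open>\<pi>\<^sub>\<sigma> = \<pi>\<^sub>\<rho>\<close>, the equations of \<open>\<pi>\<^sub>\<rho>\<close> for
  this point say that \<open>b\<^bsub>\<sigma>(j)\<^esub> = a b\<^bsub>\<rho>(j)\<^esub> + c\<close> for all \<open>j\<close>. A translation, the case \<open>a = 1\<close>, would change the
  sum of the elements of \<open>B\<close> by \<open>n c\<close>, so that \<open>c = 0\<close> and \<open>\<sigma> = \<rho>\<close>.\<close>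

lemma exceptional_imp_affine_symmetry:
  fixes B :: "'k::field_char_0 set"
  assumes n: "n \<ge> 3" and ex: "exceptional_set n B"
  obtains a c where "a \<noteq> 0" "a \<noteq> 1" "(\<lambda>t. a * t + c) ` B = B"
proof -
  have B: "finite B" "card B = n" and chi: "chi n B < fact n"
    using ex by (auto simp: exceptional_set_def nsubsets_def)
  then obtain b where b: "bij_betw b {1..n} B" using ex_bij_betw_nat_finite_1 by blast
  then have inj: "inj_on b {1..n}" and im: "b ` {1..n} = B" by (auto simp: bij_betw_def)
  have "card (char_plane n b ` {\<sigma>. \<sigma> permutes {1..n}}) \<noteq> card {\<sigma>. \<sigma> permutes {1..n}}"
    using chi chi_eq[OF b] card_permutations[of "{1..n}" n] by (simp add: char_planes_def)
  then have "\<not> inj_on (char_plane n b) {\<sigma>. \<sigma> permutes {1..n}}" using card_image by blast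
  then obtain \<sigma> \<rho> where \<sigma>: "\<sigma> permutes {1..n}" and \<rho>: "\<rho> permutes {1..n}" and neq: "\<sigma> \<noteq> \<rho>"
    and planes: "char_plane n b \<sigma> = char_plane n b \<rho>"
    unfolding inj_on_def by blast
  have mem: "\<sigma> i \<in> {1..n}" "\<rho> i \<in> {1..n}" if "i \<in> {1..n}" for i
    using that permutes_in_image[OF \<sigma>] permutes_in_image[OF \<rho>] by blast+
  have I: "1 \<in> {1..n}" "2 \<in> {1..n}" using n by auto
  define x where "x = (\<lambda>i\<in>{1..n}. b (\<sigma> i))"
  have xi: "x i = b (\<sigma> i)" if "i \<in> {1..n}" for i using that by (simp add: x_def)
  have "x \<in> char_plane n b \<sigma>"
    unfolding char_plane_def
  proof (intro CollectI conjI ballI)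
    show "x \<in> affine_space n" by (simp add: x_def affine_space_def)
    fix j assume "j \<in> {3..n}"
    then have "j \<in> {1..n}" by auto
    then show "(b (\<sigma> j) - b (\<sigma> 2)) * x 1 + (b (\<sigma> 1) - b (\<sigma> j)) * x 2 + (b (\<sigma> 2) - b (\<sigma> 1)) * x j = 0"
      unfolding xi[OF I(1)] xi[OF I(2)] by (simp only: xi) (simp add: algebra_simps)
  qed
  then have "\<forall>j\<in>{3..n}. (b (\<rho> j) - b (\<rho> 2)) * x 1 + (b (\<rho> 1) - b (\<rho> j)) * x 2 + (b (\<rho> 2) - b (\<rho> 1)) * x j = 0"
    unfolding planes unfolding char_plane_def mem_Collect_eq by (rule conjunct2)
  then have plane: "(b (\<rho> j) - b (\<rho> 2)) * x 1 + (b (\<rho> 1) - b (\<rho> j)) * x 2 + (b (\<rho> 2) - b (\<rho> 1)) * x j = 0"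
    if "j \<in> {3..n}" for j
    using that by (rule bspec)
  have "\<rho> 1 \<noteq> \<rho> 2" "\<sigma> 1 \<noteq> \<sigma> 2" using permutes_inj[OF \<rho>] permutes_inj[OF \<sigma>] by (simp_all add: inj_eq)
  then have d: "b (\<rho> 2) - b (\<rho> 1) \<noteq> 0" and d': "b (\<sigma> 2) - b (\<sigma> 1) \<noteq> 0"
    using inj_on_eq_iff[OF inj] mem I by (metis right_minus_eq)+
  define a where "a = (x 2 - x 1) / (b (\<rho> 2) - b (\<rho> 1))"
  define c where "c = x 1 - a * b (\<rho> 1)"
  have aff: "b (\<sigma> j) = a * b (\<rho> j) + c" if j: "j \<in> {1..n}" for j
  proof -
    have ad: "a * (b (\<rho> 2) - b (\<rho> 1)) = x 2 - x 1" using d by (simp add: a_def)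
    consider "j = 1" | "j = 2" | "j \<in> {3..n}" using j by fastforce
    then have "x j = a * b (\<rho> j) + c"
    proof cases
      case 2
      then show ?thesis using ad by (simp add: c_def algebra_simps)
    next
      case 3
      have "(b (\<rho> 2) - b (\<rho> 1)) * x j = b (\<rho> j) * (x 2 - x 1) + b (\<rho> 2) * x 1 - b (\<rho> 1) * x 2"
        using plane[OF 3] by (simp add: algebra_simps)
      also have "\<dots> = (x 2 - x 1) * b (\<rho> j) + (b (\<rho> 2) - b (\<rho> 1)) * x 1 - (x 2 - x 1) * b (\<rho> 1)"
        by (simp add: algebra_simps)
      also have "\<dots> = (b (\<rho> 2) - b (\<rho> 1)) * (a * b (\<rho> j) + c)"
        unfolding ad[symmetric] c_def by (simp add: algebra_simps)
      finally show ?thesis using d by simp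
    qed (simp add: c_def)
    then show ?thesis using xi[OF j] by simp
  qed
  have "(\<lambda>t. a * t + c) ` B = (\<lambda>t. a * t + c) ` (b ` (\<rho> ` {1..n}))"
    unfolding permutes_image[OF \<rho>] im ..
  also have "\<dots> = b ` (\<sigma> ` {1..n})" unfolding image_image using aff by (intro image_cong) auto
  also have "\<dots> = B" unfolding permutes_image[OF \<sigma>] im ..
  finally have sym: "(\<lambda>t. a * t + c) ` B = B" .
  have "a \<noteq> 0" using d d' xi[OF I(1)] xi[OF I(2)] by (simp add: a_def)
  moreover have "a \<noteq> 1"
  proof
    assume a: "a = 1"
    have "(\<Sum>t\<in>B. t) = (\<Sum>t\<in>(\<lambda>t. t + c) ` B. t)" using sym a by simp
    also have "\<dots> = (\<Sum>t\<in>B. t + c)" by (subst sum.reindex) (auto simp: inj_on_def)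
    also have "\<dots> = (\<Sum>t\<in>B. t) + of_nat n * c" using B by (simp add: sum.distrib)
    finally have "c = 0" using n by simp
    then have "b (\<sigma> i) = b (\<rho> i)" if "i \<in> {1..n}" for i using aff[OF that] a by simp
    then have "\<sigma> i = \<rho> i" if "i \<in> {1..n}" for i
      using that inj_onD[OF inj] mem by metis
    moreover have "\<sigma> i = \<rho> i" if "i \<notin> {1..n}" for i
      using that permutes_not_in[OF \<sigma>] permutes_not_in[OF \<rho>] by metis
    ultimately show False using neq by blast
  qed
  ultimately show ?thesis using sym that by blast
qed

text \<open>In a generating set \<open>R\<close> of least cardinality no element is \<open>a\<close> times another one. Hence \<open>R\<close> and
  \<open>a R\<close> are disjoint subsets of \<open>B\<close> of the same size.\<close>

lemma multiplicative_orbit_representatives: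
  fixes a :: "'k::field"
  assumes fin: "finite B" and zero: "0 \<notin> B" and a: "a \<noteq> 1" and sym: "(\<lambda>t. a * t) ` B = B"
  obtains R where "R \<subseteq> B" "2 * card R \<le> card B" "\<And>b. b \<in> B \<Longrightarrow> \<exists>r\<in>R. \<exists>i. b = a ^ i * r"
proof -
  define gen where "gen R \<longleftrightarrow> R \<subseteq> B \<and> (\<forall>b\<in>B. \<exists>r\<in>R. \<exists>i. b = a ^ i * r)" for R
  have "\<exists>r\<in>B. \<exists>i. b = a ^ i * r" if "b \<in> B" for b
    using that by (intro bexI[of _ b] exI[of _ 0]) auto
  then have "gen B" by (simp add: gen_def)
  then obtain R where R: "gen R" and min: "\<And>S. gen S \<Longrightarrow> card R \<le> card S"
    using ex_has_least_nat[of gen B card] by blast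
  have RB: "R \<subseteq> B" and finR: "finite R" using R fin by (auto simp: gen_def intro: finite_subset)
  have "R \<inter> (\<lambda>t. a * t) ` R = {}"
  proof (rule ccontr)
    assume "R \<inter> (\<lambda>t. a * t) ` R \<noteq> {}"
    then obtain r r' where r: "r \<in> R" "r' \<in> R" "r = a * r'" by blast
    then have "r' \<noteq> 0" using RB zero by blast
    then have neq: "r' \<noteq> r" using r(3) a by auto
    have "gen (R - {r})"
      unfolding gen_def
    proof (intro conjI ballI)
      show "R - {r} \<subseteq> B" using RB by blast
      fix b assume "b \<in> B"
      then obtain u i where u: "u \<in> R" "b = a ^ i * u" using R unfolding gen_def by blast
      show "\<exists>u\<in>R - {r}. \<exists>i. b = a ^ i * u"
      proof (cases "u = r")
        case True
        then have "b = a ^ Suc i * r'" using u r(3) by simp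
        then show ?thesis using r(2) neq by blast
      next
        case False
        then show ?thesis using u by blast
      qed
    qed
    then have "card R \<le> card (R - {r})" by (rule min)
    then show False using r(1) finR by (metis card_Diff1_less leD)
  qed
  moreover have "a \<noteq> 0 \<or> R = {}" using sym RB zero by fastforce
  then have "card ((\<lambda>t. a * t) ` R) = card R" by (auto intro!: card_image simp: inj_on_def)
  moreover have "R \<union> (\<lambda>t. a * t) ` R \<subseteq> B" using RB sym by blast
  then have "card (R \<union> (\<lambda>t. a * t) ` R) \<le> card B" using fin card_mono by blast
  ultimately have "2 * card R \<le> card B"
    using card_Un_disjoint[of R "(\<lambda>t. a * t) ` R"] finR by simp
  moreover have "\<exists>r\<in>R. \<exists>i. b = a ^ i * r" if "b \<in> B" for b using that R unfolding gen_def by blast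
  ultimately show ?thesis using that RB by blast
qed

lemma multiplicative_symmetry_root_of_unity:
  fixes a :: "'k::field"
  assumes fin: "finite B" and b: "b \<in> B" "b \<noteq> 0" and a: "a \<noteq> 0" and sym: "(\<lambda>t. a * t) ` B \<subseteq> B"
  obtains t where "t \<in> {1..card B}" "a ^ t = 1"
proof -
  have mem: "a ^ i * b \<in> B" for i
    by (induction i) (use b sym in \<open>auto simp: mult.assoc\<close>)
  then have "(\<lambda>i. a ^ i * b) ` {..card B} \<subseteq> B" by blast
  then have "card ((\<lambda>i. a ^ i * b) ` {..card B}) < card {..card B}"
    using card_mono[OF fin] by (simp add: le_imp_less_Suc)
  then have "\<not> inj_on (\<lambda>i. a ^ i * b) {..card B}" by (rule pigeonhole)
  then obtain i j where "i \<in> {..card B}" "j \<in> {..card B}" "a ^ i * b = a ^ j * b" "i \<noteq> j"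
    unfolding inj_on_def by blast
  then have "\<exists>i j. i < j \<and> j \<le> card B \<and> a ^ i * b = a ^ j * b"
    by (metis atMost_iff linorder_neqE_nat)
  then obtain i j where ij: "i < j" "j \<le> card B" "a ^ i * b = a ^ j * b" by blast
  have "a ^ j = a ^ i * a ^ (j - i)" using ij(1) by (simp flip: power_add)
  then have "a ^ (j - i) = 1" using ij(3) b(2) a by simp
  then show ?thesis using ij by (intro that[of "j - i"]) auto
qed

definition small_roots :: "nat \<Rightarrow> 'k::field set" where
  "small_roots n = insert 0 (\<Union>t\<in>{1..n}. {z. z ^ t = 1})"

lemma finite_small_roots: "finite (small_roots n :: 'k::field set)"
proof -
  have "finite {z :: 'k. z ^ t = 1}" if "t \<in> {1..n}" for t
  proof -
    have "degree (monom 1 t :: 'k poly) = t" by (simp add: degree_monom_eq)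
    then have "monom 1 t \<noteq> (1 :: 'k poly)" using that by auto
    then have "monom 1 t - 1 \<noteq> (0 :: 'k poly)" by simp
    then have "finite {z. poly (monom 1 t - 1 :: 'k poly) z = 0}" by (rule poly_roots_finite)
    then show ?thesis by (simp add: poly_monom)
  qed
  then show ?thesis by (simp add: small_roots_def del: One_nat_def)
qed

text \<open>Put the fixed point of the affine symmetry at \<open>0\<close>, and scale so that one of the at most \<open>n div 2\<close> orbit
  representatives is \<open>1\<close>. With \<open>d = n div 2 - 1\<close> the values \<open>y 0, \<dots>, y (d - 1)\<close> are the other
  representatives, the list being filled up with \<open>1\<close>, and \<open>y d = 1\<close>. Every element of the set is then a
  representative times a power of the multiplier, or \<open>0\<close>. The pair \<open>(w, l)\<close> that records this has only
  finitely many possible values.\<close>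

theorem exceptional_class_parametrization:
  fixes s :: "'k::field_char_0 set set"
  assumes n: "n \<ge> 3" and s: "s \<in> exceptional_classes n"
  obtains w l y where "w \<in> {1..n} \<rightarrow>\<^sub>E small_roots n" "l \<in> {1..n} \<rightarrow>\<^sub>E {..n div 2 - 1}"
    "y (n div 2 - 1) = 1" "(\<lambda>j\<in>{1..n}. w j * y (l j)) \<in> distinct_points n"
    "point_class n (\<lambda>j\<in>{1..n}. w j * y (l j)) = s"
proof -
  define d where "d = n div 2 - 1"
  obtain B where B: "exceptional_set n B" "s = poly_class B"
    using s by (auto simp: exceptional_classes_def)
  then have finB: "finite B" "card B = n" by (auto simp: exceptional_set_def nsubsets_def)
  obtain a c where a: "a \<noteq> 0" "a \<noteq> 1" and sym: "(\<lambda>t. a * t + c) ` B = B"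
    using exceptional_imp_affine_symmetry[OF n B(1)] by blast
  define z where "z = c / (1 - a)"
  have z: "a * z + c = z" using a(2) by (simp add: z_def field_simps)
  define B1 where "B1 = (\<lambda>t. 1 * t + - z) ` B"
  have "a * (1 * t + - z) = 1 * (a * t + c) + - z" for t
    using z by (simp add: algebra_simps)
  then have "(\<lambda>t. a * t) ` B1 = (\<lambda>t. 1 * t + - z) ` ((\<lambda>t. a * t + c) ` B)"
    unfolding B1_def image_image by presburger
  then have sym1: "(\<lambda>t. a * t) ` B1 = B1" unfolding sym B1_def .
  have B1: "finite B1" "card B1 = n" "poly_class B1 = s"
    using finB B(2) poly_class_affine_image[of 1 "- z" B]
    by (auto simp: B1_def card_image inj_on_def)
  define B0 where "B0 = B1 - {0}"
  have B0: "finite B0" "0 \<notin> B0" "card B0 \<le> n" using B1 card_mono[of B1 B0] by (auto simp: B0_def)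
  have sym0: "(\<lambda>t. a * t) ` B0 = B0"
  proof -
    have "(\<lambda>t. a * t) ` B0 = (\<lambda>t. a * t) ` B1 - {0}" using a(1) by (auto simp: B0_def)
    then show ?thesis using sym1 by (simp add: B0_def)
  qed
  have "card B1 \<le> card (insert 0 B0)" using B0(1) by (intro card_mono) (auto simp: B0_def)
  then have "card B1 \<le> Suc (card B0)" using B0(1,2) by simp
  then have "B0 \<noteq> {}" using B1(2) n by auto
  then obtain b0 where b0: "b0 \<in> B0" by blast
  obtain t where t: "t \<in> {1..card B0}" "a ^ t = 1"
    using multiplicative_symmetry_root_of_unity[OF B0(1) b0 _ a(1)] sym0 b0 B0(2) by blast
  have powers: "a ^ i \<in> small_roots n" for i
  proof -
    have "(a ^ i) ^ t = 1" using t(2) by (metis mult.commute power_mult power_one)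
    moreover have "t \<in> {1..n}" using t(1) B0(3) by auto
    ultimately show ?thesis unfolding small_roots_def by blast
  qed
  obtain R where R: "R \<subseteq> B0" "2 * card R \<le> card B0" "\<And>b. b \<in> B0 \<Longrightarrow> \<exists>r\<in>R. \<exists>i. b = a ^ i * r"
    using multiplicative_orbit_representatives[OF B0(1,2) a(2) sym0] by blast
  obtain r0 where r0: "r0 \<in> R" using R(3)[OF b0] by blast
  have r0n: "r0 \<noteq> 0" using r0 R(1) B0(2) by blast
  have finR: "finite R" using R(1) B0(1) finite_subset by blast
  define m where "m = card (R - {r0})"
  have "m = card R - 1" using r0 by (simp add: m_def)
  then have md: "m \<le> d" using R(2) B0(3) by (simp add: d_def)
  obtain h where h: "bij_betw h {0..<m} (R - {r0})"
    using ex_bij_betw_nat_finite[of "R - {r0}"] finR by (auto simp: m_def)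
  define y where "y l = (if l < m then h l else r0) / r0" for l
  have yd: "y d = 1" using md r0n by (simp add: y_def)
  have yR: "\<exists>l\<le>d. r / r0 = y l" if "r \<in> R" for r
  proof (cases "r = r0")
    case True
    then show ?thesis using yd r0n by (intro exI[of _ d]) simp
  next
    case False
    then have "r \<in> h ` {0..<m}" using h that by (simp add: bij_betw_def)
    then obtain l where "l < m" "r = h l" by auto
    then show ?thesis using md by (intro exI[of _ l]) (simp add: y_def)
  qed
  define B2 where "B2 = (\<lambda>t. (1 / r0) * t + 0) ` B1"
  have B2: "finite B2" "card B2 = n" "poly_class B2 = s"
    using B1 poly_class_affine_image[of "1 / r0" 0 B1] r0n
    by (auto simp: B2_def card_image inj_on_def)
  have param: "\<exists>w\<in>small_roots n. \<exists>l\<le>d. u = w * y l" if u: "u \<in> B2" for u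
  proof -
    obtain b where b: "b \<in> B1" "u = b / r0" using u by (auto simp: B2_def)
    show ?thesis
    proof (cases "b = 0")
      case True
      then show ?thesis using b by (intro bexI[of _ 0] exI[of _ 0]) (auto simp: small_roots_def)
    next
      case False
      then have "b \<in> B0" using b(1) by (simp add: B0_def)
      from R(3)[OF this] obtain r i where "r \<in> R" "b = a ^ i * r" by blast
      moreover obtain l where "l \<le> d" "r / r0 = y l" using yR[OF \<open>r \<in> R\<close>] by blast
      ultimately show ?thesis using b(2) powers[of i] by (metis times_divide_eq_right)
    qed
  qed
  obtain e where e: "bij_betw e {1..n} B2" using ex_bij_betw_nat_finite_1[OF B2(1)] B2(2) by blast
  have "\<forall>j\<in>{1..n}. \<exists>w l. w \<in> small_roots n \<and> l \<le> d \<and> e j = w * y l"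
    using param e unfolding bij_betw_def by blast
  then obtain w l where wl: "\<And>j. j \<in> {1..n} \<Longrightarrow> w j \<in> small_roots n \<and> l j \<le> d \<and> e j = w j * y (l j)"
    by metis
  define w' l' where "w' = restrict w {1..n}" and "l' = restrict l {1..n}"
  define x where "x = (\<lambda>j\<in>{1..n}. w' j * y (l' j))"
  have x: "x = restrict e {1..n}" using wl by (auto simp: x_def w'_def l'_def)
  have "x \<in> distinct_points n"
    using e unfolding x by (simp add: distinct_points_def affine_space_def bij_betw_def)
  moreover have "x ` {1..n} = B2" using e unfolding x by (simp add: bij_betw_def)
  then have "point_class n x = s" using B2(3) by (simp add: point_class_def)
  moreover have "w' \<in> {1..n} \<rightarrow>\<^sub>E small_roots n" "l' \<in> {1..n} \<rightarrow>\<^sub>E {..d}"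
    using wl by (auto simp: w'_def l'_def)
  ultimately show ?thesis using that[of w' l' y] yd unfolding x_def d_def by blast
qed

section \<open>The upper bound for the dimension\<close>

text \<open>A chain of length \<open>d + 1\<close> would give \<open>d + 1\<close> algebraically independent regular functions, but on the
  exceptional classes these are rational functions of \<open>d\<close> parameters.\<close>

theorem krull_dim_exceptional_le:
  fixes T :: "'k::{alg_closed_field, field_char_0} set set set"
  assumes n: "n \<ge> 3" and T: "T \<subseteq> exceptional_classes n"
  shows "krull_dim (subtopology (Sigma_space n) T) \<le> ereal (real (n div 2 - 1))"
proof -
  define d where "d = n div 2 - 1"
  define X where "X = subtopology (Sigma_space n) T"
  define R where "R h \<longleftrightarrow> regular n (\<lambda>x. h (point_class n x))" for h :: "'k set set \<Rightarrow> 'k"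
  have topX: "topspace X = Sigma_classes n \<inter> T" by (simp add: X_def)
  have bound: "m \<le> d"
    if Z: "\<And>i. i \<le> m \<Longrightarrow> closedin X (Z i) \<and> irreducible_space (subtopology X (Z i))"
      and chain: "\<And>i. i < m \<Longrightarrow> Z i \<subset> Z (Suc i)" for m Z
  proof (rule ccontr)
    assume "\<not> m \<le> d"
    then have dm: "Suc d \<le> m" by simp
    have "\<exists>h. R h \<and> (\<forall>z\<in>Z i. h z = 0) \<and> (\<exists>z\<in>Z (Suc i). h z \<noteq> 0)" if i: "i < m" for i
    proof -
      obtain s where s: "s \<in> Z (Suc i)" "s \<notin> Z i" using chain[OF i] by blast
      have sX: "s \<in> Sigma_classes n" "s \<in> T"
        using Z[of "Suc i"] i s(1) closedin_subset[of X] topX by auto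
      obtain C where C: "closedin (Sigma_space n) C" "Z i = C \<inter> T"
        using Z[of i] i unfolding X_def closedin_subtopology by auto
      have "n \<ge> 2" "s \<notin> C" using n s(2) sX(2) C(2) by auto
      from regular_separation[OF this(1) C(1) sX(1) this(2)] obtain h where
        "regular n (\<lambda>x. h (point_class n x))" "\<And>t. t \<in> C \<Longrightarrow> h t = 0" "h s \<noteq> (0 :: 'k)" by blast
      then show ?thesis using s(1) C(2) by (intro exI[of _ h]) (auto simp: R_def)
    qed
    then obtain g where g: "\<And>i. i < m \<Longrightarrow> R (g i)" "\<And>i z. i < m \<Longrightarrow> z \<in> Z i \<Longrightarrow> g i z = 0"
      "\<And>i. i < m \<Longrightarrow> \<exists>z\<in>Z (Suc i). g i z \<noteq> 0"
      by metis
    have indep: "\<not> algebraically_dependent (Suc d) g (Z (Suc d))"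
    proof (rule chain_algebraically_independent[where R = R and X = X])
      show "R (\<lambda>z. c)" for c unfolding R_def by (rule regular_const)
      show "R (\<lambda>z. u z + v z)" "R (\<lambda>z. u z * v z)" if "R u" "R v" for u v
        using that regular_add regular_mult unfolding R_def by blast+
      show "closedin X {z \<in> topspace X. u z = 0}" if "R u" for u
      proof -
        have "closedin (Sigma_space n) {z \<in> Sigma_classes n. u z = 0}"
          using that unfolding R_def by (rule closedin_regular_zeros)
        moreover have "{z \<in> topspace X. u z = 0} = {z \<in> Sigma_classes n. u z = 0} \<inter> T"
          using topX by blast
        ultimately show ?thesis unfolding X_def closedin_subtopology by blast
      qed
      show "Z i \<subseteq> Z (Suc i)" if "i < Suc d" for i using chain[of i] that dm by auto
    qed (use Z g dm in auto)
    have reg: "\<exists>p q. p \<in> mpolys n \<and> q \<in> mpolys n \<and> (\<forall>x\<in>distinct_points n.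
        mpoly_eval q x \<noteq> 0 \<and> g i (point_class n x) * mpoly_eval q x = mpoly_eval p x)" if i: "i \<le> d" for i
    proof -
      have "R (g i)" using g(1) dm i by simp
      then show ?thesis unfolding R_def regular_def poly_function_def by metis
    qed
    then obtain P P' where P: "\<And>i. i \<le> d \<Longrightarrow> P i \<in> mpolys n" "\<And>i. i \<le> d \<Longrightarrow> P' i \<in> mpolys n"
      and frac: "\<And>i x. i \<le> d \<Longrightarrow> x \<in> distinct_points n \<Longrightarrow>
        mpoly_eval (P' i) x \<noteq> 0 \<and> g i (point_class n x) * mpoly_eval (P' i) x = mpoly_eval (P i) x"
      by metis
    define W :: "(nat \<Rightarrow> 'k) set" where "W = ({1..n} \<rightarrow>\<^sub>E small_roots n)"
    define L where "L = ({1..n} \<rightarrow>\<^sub>E {..d})"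
    \<comment> \<open>The point with pattern \<open>k = (w, l)\<close> and parameters \<open>y\<close>; the value of index \<open>d\<close> is normalized to \<open>1\<close>.\<close>
    define \<psi> :: "(nat \<Rightarrow> 'k) \<times> (nat \<Rightarrow> nat) \<Rightarrow> (nat \<Rightarrow> 'k) \<Rightarrow> nat \<Rightarrow> 'k" where
      "\<psi> k y = (\<lambda>j\<in>{1..n}. fst k j * (if snd k j = d then 1 else y (snd k j)))" for k y
    have box: "\<exists>M. box_polynomial d M (\<lambda>y. mpoly_eval p (\<psi> k y))"
      if p: "p \<in> mpolys n" and k: "k \<in> W \<times> L" for p k
    proof (rule mpoly_eval_closure[where Q = "\<lambda>F. \<exists>M. box_polynomial d M F" and c = "\<psi> k", OF _ _ _ _ p])
      show "\<exists>M. box_polynomial d M (\<lambda>y. c)" for c :: 'k using box_polynomial_const by blast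
      show "\<exists>M. box_polynomial d M (\<lambda>y. F y + G y)"
        if "\<exists>M. box_polynomial d M F" "\<exists>M. box_polynomial d M G" for F G :: "(nat \<Rightarrow> 'k) \<Rightarrow> 'k"
      proof -
        from that obtain M N where "box_polynomial d M F" "box_polynomial d N G" by blast
        then have "box_polynomial d (M + N) F" "box_polynomial d (M + N) G"
          by (auto elim: box_polynomial_mono)
        then show ?thesis using box_polynomial_add by blast
      qed
      show "\<exists>M. box_polynomial d M (\<lambda>y. F y * G y)"
        if "\<exists>M. box_polynomial d M F" "\<exists>M. box_polynomial d M G" for F G :: "(nat \<Rightarrow> 'k) \<Rightarrow> 'k"
        using that box_polynomial_mult by blast
      show "\<exists>M. box_polynomial d M (\<lambda>y. \<psi> k y j)" if j: "j \<in> {1..n}" for j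
      proof (cases "snd k j = d")
        case True
        then have "(\<lambda>y. \<psi> k y j) = (\<lambda>y. fst k j)" using j by (simp add: \<psi>_def)
        then show ?thesis using box_polynomial_const[of d 0 "fst k j"] by metis
      next
        case False
        moreover have "snd k j \<le> d" using k j by (auto simp: L_def)
        ultimately have "snd k j < d" by simp
        moreover have "(\<lambda>y. \<psi> k y j) = (\<lambda>y. fst k j * y (snd k j))" using j False by (simp add: \<psi>_def)
        ultimately show ?thesis
          using box_polynomial_mult[OF box_polynomial_const[of d 0 "fst k j"] box_polynomial_coord] by metis
      qed
    qed
    have "algebraically_dependent (Suc d) g (Z (Suc d))"
    proof (rule algebraically_dependent_by_counting[where Q = "W \<times> L"
          and p = "\<lambda>k i y. mpoly_eval (P i) (\<psi> k y)" and q = "\<lambda>k i y. mpoly_eval (P' i) (\<psi> k y)"])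
      show "finite (W \<times> L)"
        unfolding W_def L_def by (intro finite_cartesian_product finite_PiE finite_small_roots) auto
    next
      fix k i assume k: "k \<in> W \<times> L" and i: "i \<le> d"
      obtain M N where "box_polynomial d M (\<lambda>y. mpoly_eval (P i) (\<psi> k y))"
        "box_polynomial d N (\<lambda>y. mpoly_eval (P' i) (\<psi> k y))"
        using box[OF P(1)[OF i] k] box[OF P(2)[OF i] k] by blast
      then have "box_polynomial d (M + N) (\<lambda>y. mpoly_eval (P i) (\<psi> k y))"
        "box_polynomial d (M + N) (\<lambda>y. mpoly_eval (P' i) (\<psi> k y))"
        by (auto elim: box_polynomial_mono)
      then show "\<exists>M. box_polynomial d M (\<lambda>y. mpoly_eval (P i) (\<psi> k y)) \<and>
          box_polynomial d M (\<lambda>y. mpoly_eval (P' i) (\<psi> k y))" by blast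
    next
      fix z assume "z \<in> Z (Suc d)"
      moreover have "Z (Suc d) \<subseteq> T" using Z[OF dm] closedin_subset[of X] topX by blast
      ultimately have "z \<in> exceptional_classes n" using T by blast
      from exceptional_class_parametrization[OF n this] obtain w l y where
        wl: "w \<in> W" "l \<in> L" and y: "y d = 1" and x: "(\<lambda>j\<in>{1..n}. w j * y (l j)) \<in> distinct_points n"
        "point_class n (\<lambda>j\<in>{1..n}. w j * y (l j)) = z"
        unfolding W_def L_def d_def by blast
      have "\<psi> (w, l) y = (\<lambda>j\<in>{1..n}. w j * y (l j))" using y by (auto simp: \<psi>_def)
      then show "\<exists>k\<in>W \<times> L. \<exists>y. \<forall>i\<le>d. mpoly_eval (P' i) (\<psi> k y) \<noteq> 0 \<and>
          g i z * mpoly_eval (P' i) (\<psi> k y) = mpoly_eval (P i) (\<psi> k y)"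
        using frac[OF _ x(1)] x(2) wl by (intro bexI[of _ "(w, l)"] exI[of _ y]) auto
    qed
    then show False using indep by contradiction
  qed
  show ?thesis
    unfolding krull_dim_def X_def[symmetric] d_def[symmetric]
  proof (rule Sup_least, elim CollectE exE conjE)
    fix x m Z
    assume "x = ereal (real m)"
      and "\<forall>i\<le>m. closedin X (Z i) \<and> irreducible_space (subtopology X (Z i))" "\<forall>i<m. Z i \<subset> Z (Suc i)"
    then show "x \<le> ereal (real d)" using bound[of m Z] by simp
  qed
qed

section \<open>Symmetric sets are exceptional with even symmetry group\<close>

text \<open>The orbits of the involution partition \<open>A\<close> into sets with two elements.\<close>

lemma even_card_fixpoint_free_involution:
  assumes fin: "finite A" and im: "\<And>x. x \<in> A \<Longrightarrow> \<iota> x \<in> A"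
    and invol: "\<And>x. x \<in> A \<Longrightarrow> \<iota> (\<iota> x) = x" and free: "\<And>x. x \<in> A \<Longrightarrow> \<iota> x \<noteq> x"
  shows "even (card A)"
proof -
  define C where "C = (\<lambda>x. {x, \<iota> x}) ` A"
  have U: "\<Union>C = A" using im by (auto simp: C_def)
  have "card {x, \<iota> x} = 2" if "x \<in> A" for x using free[OF that] by auto
  then have two: "\<forall>c\<in>C. 2 dvd card c" by (auto simp: C_def)
  have disj: "c1 \<inter> c2 = {}" if c: "c1 \<in> C" "c2 \<in> C" "c1 \<noteq> c2" for c1 c2
  proof (rule ccontr)
    obtain x y where x: "x \<in> A" "c1 = {x, \<iota> x}" and y: "y \<in> A" "c2 = {y, \<iota> y}" using c by (auto simp: C_def)
    assume "c1 \<inter> c2 \<noteq> {}"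
    then have "x = y \<or> x = \<iota> y \<or> \<iota> x = y \<or> \<iota> x = \<iota> y" using x(2) y(2) by blast
    then have "x = y \<or> x = \<iota> y" using invol x(1) y(1) by metis
    then show False using c(3) x(2) y(2) invol[OF y(1)] by auto
  qed
  have "2 dvd card (\<Union>C)" by (rule dvd_partition) (use fin U two disj in auto)
  then show ?thesis using U by simp
qed

text \<open>The permutation \<open>\<rho>\<close> that realizes \<open>b \<mapsto> -b\<close> changes the sign of all coefficients of the linear system, so
  it has the same plane as the identity.\<close>

lemma symmetric_exceptional_set:
  fixes B :: "'k::field_char_0 set"
  assumes n: "n \<ge> 2" and B: "B \<in> nsubsets n" and sym: "uminus ` B = B"
  shows "exceptional_set n B"
proof -
  have fin: "finite B" "card B = n" using B by (auto simp: nsubsets_def)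
  obtain b where b: "bij_betw b {1..n} B" using ex_bij_betw_nat_finite_1[OF fin(1)] fin(2) by blast
  define \<rho> where "\<rho> i = (if i \<in> {1..n} then inv_into {1..n} b (- b i) else i)" for i
  have neg: "bij_betw uminus B B" using sym by (simp add: bij_betw_def inj_on_def)
  have "bij_betw (inv_into {1..n} b \<circ> (uminus \<circ> b)) {1..n} {1..n}"
    using bij_betw_trans[OF bij_betw_trans[OF b neg] bij_betw_inv_into[OF b]] .
  then have "bij_betw \<rho> {1..n} {1..n}"
    by (rule bij_betw_cong[THEN iffD1, rotated]) (simp add: \<rho>_def)
  then have \<rho>: "\<rho> permutes {1..n}" by (rule bij_imp_permutes) (auto simp: \<rho>_def)
  have b\<rho>: "b (\<rho> i) = - b i" if "i \<in> {1..n}" for i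
  proof -
    have "- b i \<in> B" using that b sym by (auto simp: bij_betw_def)
    then show ?thesis using bij_betw_inv_into_right[OF b, of "- b i"] that by (simp add: \<rho>_def)
  qed
  have "char_plane n b \<rho> = char_plane n b id"
  proof -
    have "((b (\<rho> j) - b (\<rho> 2)) * x 1 + (b (\<rho> 1) - b (\<rho> j)) * x 2 + (b (\<rho> 2) - b (\<rho> 1)) * x j = 0) \<longleftrightarrow>
        ((b (id j) - b (id 2)) * x 1 + (b (id 1) - b (id j)) * x 2 + (b (id 2) - b (id 1)) * x j = 0)"
      if "j \<in> {3..n}" for j and x :: "nat \<Rightarrow> 'k"
    proof -
      have m: "j \<in> {1..n}" "1 \<in> {1..n}" "2 \<in> {1..n}" using that by auto
      have "(b (\<rho> j) - b (\<rho> 2)) * x 1 + (b (\<rho> 1) - b (\<rho> j)) * x 2 + (b (\<rho> 2) - b (\<rho> 1)) * x j =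
        - ((b (id j) - b (id 2)) * x 1 + (b (id 1) - b (id j)) * x 2 + (b (id 2) - b (id 1)) * x j)"
        unfolding b\<rho>[OF m(1)] b\<rho>[OF m(2)] b\<rho>[OF m(3)] by (simp add: algebra_simps)
      then show ?thesis by (metis neg_equal_0_iff_equal)
    qed
    then show ?thesis unfolding char_plane_def by (intro Collect_cong conj_cong ball_cong refl)
  qed
  moreover have "\<rho> \<noteq> id"
  proof
    assume "\<rho> = id"
    then have "b i = 0" if "i \<in> {1..n}" for i using b\<rho>[OF that] by simp
    moreover have "(1::nat) \<in> {1..n}" "2 \<in> {1..n}" using n by auto
    ultimately have "b 1 = b 2" by metis
    then show False using b n inj_on_eq_iff[of b "{1..n}" 1 2] by (simp add: bij_betw_def)
  qed
  moreover have "id permutes {1..n}" by (rule permutes_id)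
  ultimately have "\<not> inj_on (char_plane n b) {\<sigma>. \<sigma> permutes {1..n}}"
    using \<rho> unfolding inj_on_def by blast
  moreover have finP: "finite {\<sigma>. \<sigma> permutes {1..n}}" by (simp add: finite_permutations)
  ultimately have "card (char_planes n b) \<noteq> card {\<sigma>. \<sigma> permutes {1..n}}"
    using eq_card_imp_inj_on unfolding char_planes_def by blast
  moreover have "card (char_planes n b) \<le> card {\<sigma>. \<sigma> permutes {1..n}}"
    unfolding char_planes_def using finP by (rule card_image_le)
  moreover have "card {\<sigma>. \<sigma> permutes {1..n}} = fact n" by (rule card_permutations) auto
  ultimately show ?thesis
    using B chi_eq[OF b] by (simp add: exceptional_set_def)
qed

text \<open>Composition with the negation \<open>\<tau>\<close> of \<open>B\<close> is an involution of the group without fixed points.\<close>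

lemma symmetric_even_char_perm_group:
  fixes B :: "'k::field_char_0 set"
  assumes n: "n \<ge> 2" and B: "B \<in> nsubsets n" and sym: "uminus ` B = B"
  shows "even (card (char_perm_group B))"
proof -
  have fin: "finite B" "card B = n" using B by (auto simp: nsubsets_def)
  define \<tau> where "\<tau> t = (if t \<in> B then - t else t)" for t
  have negB: "- t \<in> B" if "t \<in> B" for t using that sym by blast
  have \<tau>2: "\<tau> (\<tau> t) = t" for t using negB by (simp add: \<tau>_def)
  have "bij_betw \<tau> B B" by (rule bij_betw_byWitness[where f' = \<tau>]) (auto simp: \<tau>2 \<tau>_def negB)
  then have \<tau>: "\<tau> permutes B" by (rule bij_imp_permutes) (simp add: \<tau>_def)
  show ?thesis
  proof (rule even_card_fixpoint_free_involution[where \<iota> = "\<lambda>\<pi>. \<tau> \<circ> \<pi>"])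
    show "finite (char_perm_group B)"
      by (rule finite_subset[OF _ finite_permutations[OF fin(1)]]) (auto simp: char_perm_group_def)
    fix \<pi> assume "\<pi> \<in> char_perm_group B"
    then have \<pi>: "\<pi> permutes B" and "\<exists>c. \<forall>b\<in>B. \<forall>b'\<in>B. b \<noteq> b' \<longrightarrow> (\<pi> b - \<pi> b') / (b - b') = c"
      by (simp_all add: char_perm_group_def)
    from this(2) obtain c where c: "\<forall>b\<in>B. \<forall>b'\<in>B. b \<noteq> b' \<longrightarrow> (\<pi> b - \<pi> b') / (b - b') = c" ..
    have mem: "\<pi> b \<in> B" if "b \<in> B" for b using that permutes_in_image[OF \<pi>] by blast
    have "((\<tau> \<circ> \<pi>) b - (\<tau> \<circ> \<pi>) b') / (b - b') = - c" if "b \<in> B" "b' \<in> B" "b \<noteq> b'" for b b'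
    proof -
      have "(\<tau> \<circ> \<pi>) b - (\<tau> \<circ> \<pi>) b' = - (\<pi> b - \<pi> b')" using mem that by (simp add: \<tau>_def)
      moreover have "(\<pi> b - \<pi> b') / (b - b') = c" using c that by simp
      ultimately show ?thesis by (metis minus_divide_left)
    qed
    then have "\<exists>c. \<forall>b\<in>B. \<forall>b'\<in>B. b \<noteq> b' \<longrightarrow> ((\<tau> \<circ> \<pi>) b - (\<tau> \<circ> \<pi>) b') / (b - b') = c"
      by (intro exI[of _ "- c"] ballI impI)
    then show "\<tau> \<circ> \<pi> \<in> char_perm_group B"
      using permutes_compose[OF \<pi> \<tau>] by (simp add: char_perm_group_def)
    show "\<tau> \<circ> (\<tau> \<circ> \<pi>) = \<pi>" by (simp add: fun_eq_iff \<tau>2)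
    show "\<tau> \<circ> \<pi> \<noteq> \<pi>"
    proof
      assume eq: "\<tau> \<circ> \<pi> = \<pi>"
      have "t = 0" if "t \<in> B" for t
      proof -
        obtain u where "t = \<pi> u" using permutes_surj[OF \<pi>] by (metis surjD)
        then have "\<tau> t = t" using eq by (metis comp_apply)
        then show ?thesis using that by (simp add: \<tau>_def)
      qed
      then have "B \<subseteq> {0}" by blast
      then have "card B \<le> card {0::'k}" by (intro card_mono) auto
      then show False using fin(2) n by simp
    qed
  qed
qed

section \<open>Irreducibility of images of linear sections\<close>

lemma irreducible_closure_of:
  assumes S: "S \<subseteq> topspace X" "S \<noteq> {}"
    and irr: "\<And>C E. closedin X C \<Longrightarrow> closedin X E \<Longrightarrow> S \<subseteq> C \<union> E \<Longrightarrow> S \<subseteq> C \<or> S \<subseteq> E"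
  shows "irreducible_space (subtopology X (X closure_of S))"
proof -
  let ?K = "X closure_of S"
  have top: "topspace (subtopology X ?K) = ?K" using closure_of_subset_topspace[of X S] by auto
  have SK: "S \<subseteq> ?K" using closure_of_subset[OF S(1)] .
  have sub: "closedin X C" "C \<subseteq> ?K" if "closedin (subtopology X ?K) C" for C
    using that closedin_closed_subtopology[OF closedin_closure_of[of X S]] by simp_all
  have full: "C = ?K" if "closedin (subtopology X ?K) C" "S \<subseteq> C" for C
    using closure_of_minimal[OF that(2) sub(1)[OF that(1)]] sub(2)[OF that(1)] by blast
  show ?thesis
    unfolding irreducible_space_def top
  proof (intro conjI allI impI)
    show "?K \<noteq> {}" using S(2) SK by blast
    fix C E assume CE: "closedin (subtopology X ?K) C \<and> closedin (subtopology X ?K) E \<and> ?K = C \<union> E"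
    then have "S \<subseteq> C \<or> S \<subseteq> E" using irr[of C E] sub(1) SK by blast
    then show "C = ?K \<or> E = ?K" using full CE by blast
  qed
qed

text \<open>If \<open>p\<close> does not vanish at \<open>x\<close> and \<open>q\<close> does not vanish at \<open>y\<close>, then on the line through \<open>x\<close> and \<open>y\<close> both
  are nonzero polynomials in one variable, and so are the differences of any two coordinates. A value
  of the variable that is a root of none of them gives a point of \<open>A\<close> at which \<open>p\<close> and \<open>q\<close> are both
  nonzero.\<close>

lemma line_closed_prime:
  fixes A :: "(nat \<Rightarrow> 'k::field_char_0) set"
  assumes A: "A \<subseteq> distinct_points n"
    and line: "\<And>x y t. x \<in> A \<Longrightarrow> y \<in> A \<Longrightarrow>
      (\<lambda>i\<in>{1..n}. x i + t * (y i - x i)) \<in> distinct_points n \<Longrightarrow> (\<lambda>i\<in>{1..n}. x i + t * (y i - x i)) \<in> A"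
    and p: "p \<in> mpolys n" and q: "q \<in> mpolys n"
    and prod: "\<And>x. x \<in> A \<Longrightarrow> mpoly_eval p x = 0 \<or> mpoly_eval q x = 0"
  shows "(\<forall>x\<in>A. mpoly_eval p x = 0) \<or> (\<forall>x\<in>A. mpoly_eval q x = 0)"
proof (rule ccontr)
  assume "\<not> ?thesis"
  then obtain x y where x: "x \<in> A" "mpoly_eval p x \<noteq> 0" and y: "y \<in> A" "mpoly_eval q y \<noteq> 0" by blast
  define z where "z t = (\<lambda>i\<in>{1..n}. x i + t * (y i - x i))" for t
  have ext: "u = restrict u {1..n}" if "u \<in> A" for u
    using that A by (force simp: distinct_points_def affine_space_def PiE_def extensional_restrict)
  have z0: "z 0 = x" using ext[OF x(1)] by (simp add: z_def)
  have z1: "z 1 = y" using ext[OF y(1)] by (simp add: z_def)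
  obtain P where P: "\<And>t. mpoly_eval p (z t) = poly P t"
    using mpoly_eval_on_line[OF p, of x "\<lambda>i. y i - x i"] unfolding z_def by blast
  obtain P' where P': "\<And>t. mpoly_eval q (z t) = poly P' t"
    using mpoly_eval_on_line[OF q, of x "\<lambda>i. y i - x i"] unfolding z_def by blast
  have "P \<noteq> 0" "P' \<noteq> 0" using x(2) y(2) P[of 0] P'[of 1] z0 z1 by auto
  moreover define J where "J = {(i, j) \<in> {1..n} \<times> {1..n}. i \<noteq> j}"
  define pair where "pair k = [:x (fst k) - x (snd k), (y (fst k) - x (fst k)) - (y (snd k) - x (snd k)):]" for k
  have finJ: "finite J" by (rule finite_subset[of _ "{1..n} \<times> {1..n}"]) (auto simp: J_def)
  have "[:x i - x j, (y i - x i) - (y j - x j):] \<noteq> 0" if "i \<in> {1..n}" "j \<in> {1..n}" "i \<noteq> j" for i j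
  proof -
    have "inj_on x {1..n}" using x(1) A by (auto simp: distinct_points_def)
    then show ?thesis using that inj_on_eq_iff[of x "{1..n}" i j] by simp
  qed
  then have "finite (\<Union>k\<in>J. {t. poly (pair k) t = 0})"
    using finJ by (intro finite_UN_I poly_roots_finite) (auto simp: J_def pair_def)
  ultimately have "finite ({t. poly P t = 0} \<union> {t. poly P' t = 0} \<union> (\<Union>k\<in>J. {t. poly (pair k) t = 0}))"
    by (intro finite_UnI poly_roots_finite)
  then obtain t where "t \<notin> {t. poly P t = 0} \<union> {t. poly P' t = 0} \<union> (\<Union>k\<in>J. {t. poly (pair k) t = 0})"
    using ex_new_if_finite[OF infinite_UNIV_char_0] by metis
  then have t: "poly P t \<noteq> 0" "poly P' t \<noteq> 0" and inj: "\<And>k. k \<in> J \<Longrightarrow> poly (pair k) t \<noteq> 0" by blast+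
  have "inj_on (z t) {1..n}"
  proof (rule inj_onI, rule ccontr)
    fix i j assume "i \<in> {1..n}" "j \<in> {1..n}" "z t i = z t j" "i \<noteq> j"
    then show False using inj[of "(i, j)"] by (simp add: z_def J_def pair_def algebra_simps)
  qed
  then have "z t \<in> distinct_points n" by (simp add: distinct_points_def affine_space_def z_def)
  then have "z t \<in> A" using line[OF x(1) y(1)] by (simp add: z_def)
  then show False using prod t P P' by metis
qed

lemma irreducible_closure_of_line_closed:
  fixes A :: "(nat \<Rightarrow> 'k::field_char_0) set"
  assumes A: "A \<subseteq> distinct_points n" "A \<noteq> {}" and T: "point_class n ` A \<subseteq> T"
    and line: "\<And>x y t. x \<in> A \<Longrightarrow> y \<in> A \<Longrightarrow>
      (\<lambda>i\<in>{1..n}. x i + t * (y i - x i)) \<in> distinct_points n \<Longrightarrow> (\<lambda>i\<in>{1..n}. x i + t * (y i - x i)) \<in> A"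
  defines "X \<equiv> subtopology (Sigma_space n) T"
  shows "irreducible_space (subtopology X (X closure_of (point_class n ` A)))"
proof (rule irreducible_closure_of)
  show "point_class n ` A \<subseteq> topspace X"
    using A(1) T point_class_image[of n, where 'a = 'k] unfolding X_def by auto
  show "point_class n ` A \<noteq> {}" using A(2) by blast
  fix C E assume C: "closedin X C" and E: "closedin X E" and CE: "point_class n ` A \<subseteq> C \<union> E"
  have zeros: "\<exists>S\<subseteq>mpolys n. \<forall>x\<in>A. point_class n x \<in> F \<longleftrightarrow> (\<forall>p\<in>S. mpoly_eval p x = 0)"
    if F: "closedin X F" for F
  proof -
    obtain F' where F': "closedin (Sigma_space n) F'" "F = F' \<inter> T"
      using F unfolding X_def closedin_subtopology by blast
    then obtain S where S: "S \<subseteq> mpolys n"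
      "{x \<in> distinct_points n. point_class n x \<in> F'} = zero_locus n S \<inter> distinct_points n"
      unfolding closedin_Sigma_space by blast
    have "point_class n x \<in> F \<longleftrightarrow> (\<forall>p\<in>S. mpoly_eval p x = 0)" if x: "x \<in> A" for x
    proof -
      have D: "x \<in> distinct_points n" "x \<in> affine_space n" "point_class n x \<in> T"
        using x A(1) T by (auto simp: distinct_points_def)
      have "point_class n x \<in> F \<longleftrightarrow> x \<in> {x \<in> distinct_points n. point_class n x \<in> F'}" using D F'(2) by blast
      then show ?thesis unfolding S(2) using D(1,2) by (simp add: zero_locus_def)
    qed
    then show ?thesis using S(1) by blast
  qed
  obtain S where S: "S \<subseteq> mpolys n" "\<And>x. x \<in> A \<Longrightarrow> point_class n x \<in> C \<longleftrightarrow> (\<forall>p\<in>S. mpoly_eval p x = 0)"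
    using zeros[OF C] by blast
  obtain S' where S': "S' \<subseteq> mpolys n" "\<And>x. x \<in> A \<Longrightarrow> point_class n x \<in> E \<longleftrightarrow> (\<forall>p\<in>S'. mpoly_eval p x = 0)"
    using zeros[OF E] by blast
  show "point_class n ` A \<subseteq> C \<or> point_class n ` A \<subseteq> E"
  proof (rule ccontr)
    assume "\<not> ?thesis"
    then obtain x y where xy: "x \<in> A" "point_class n x \<notin> C" "y \<in> A" "point_class n y \<notin> E" by blast
    obtain p where p: "p \<in> S" "mpoly_eval p x \<noteq> 0" using S(2)[OF xy(1)] xy(2) by blast
    obtain q where q: "q \<in> S'" "mpoly_eval q y \<noteq> 0" using S'(2)[OF xy(3)] xy(4) by blast
    have "mpoly_eval p u = 0 \<or> mpoly_eval q u = 0" if "u \<in> A" for u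
      using S(2)[OF that] S'(2)[OF that] p(1) q(1) CE that by blast
    from line_closed_prime[where A = A and n = n and p = p and q = q, OF A(1) line _ _ this] p q xy(1,3) S(1) S'(1)
    show False by blast
  qed
qed

section \<open>Containing a long arithmetic progression is a closed condition\<close>

definition has_progression :: "nat \<Rightarrow> 'k::comm_ring_1 set \<Rightarrow> bool" where
  "has_progression L B \<longleftrightarrow> (\<exists>a e. e \<noteq> 0 \<and> (\<forall>t<L. a + of_nat t * e \<in> B))"

lemma has_progression_affine_image:
  fixes B :: "'k::field set"
  assumes "a \<noteq> 0" "has_progression L B"
  shows "has_progression L ((\<lambda>t. a * t + b) ` B)"
proof -
  obtain u e where e: "e \<noteq> 0" "\<And>t. t < L \<Longrightarrow> u + of_nat t * e \<in> B"
    using assms(2) unfolding has_progression_def by blast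
  have "(a * u + b) + of_nat t * (a * e) \<in> (\<lambda>t. a * t + b) ` B" if "t < L" for t
    using e(2)[OF that] by (rule rev_image_eqI) (simp add: algebra_simps)
  then show ?thesis
    unfolding has_progression_def using e(1) assms(1)
    by (intro exI[of _ "a * u + b"] exI[of _ "a * e"]) simp
qed

text \<open>For a fixed choice \<open>\<iota>\<close> of the coordinates that form the progression, the condition is a system of linear
  equations, and there are finitely many choices. Since the coordinates are distinct, \<open>\<iota> 0 \<noteq> \<iota> 1\<close> makes
  the common difference nonzero. Affine maps preserve progressions, so the condition depends only on the class.\<close>

lemma closedin_has_progression:
  fixes n L :: nat
  assumes n: "n \<ge> 2" and L: "L \<ge> 2"
  obtains K :: "'k::{alg_closed_field, field_char_0} set set set" where "closedin (Sigma_space n) K"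
    "\<And>x. x \<in> distinct_points n \<Longrightarrow> point_class n x \<in> K \<longleftrightarrow> has_progression L (x ` {1..n})"
proof -
  define K :: "'k set set set" where
    "K = point_class n ` {x \<in> distinct_points n. has_progression L (x ` {1..n})}"
  have mem: "point_class n x \<in> K \<longleftrightarrow> has_progression L (x ` {1..n})"
    if x: "x \<in> distinct_points n" for x :: "nat \<Rightarrow> 'k"
  proof
    assume "point_class n x \<in> K"
    then obtain y where y: "y \<in> distinct_points n" "has_progression L (y ` {1..n})" "point_class n y = point_class n x"
      unfolding K_def by force
    obtain a b where "a \<noteq> 0" "x ` {1..n} = (\<lambda>t. a * t + b) ` (y ` {1..n})"
      using poly_class_eq_imp_affine_image[OF distinct_points_nsubsets[OF y(1)] distinct_points_nsubsets[OF x] n]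
        y(3) unfolding point_class_def by blast
    then show "has_progression L (x ` {1..n})" using has_progression_affine_image y(2) by metis
  qed (use x in \<open>auto simp: K_def\<close>)
  define F where "F = {\<iota> \<in> {..<L} \<rightarrow>\<^sub>E {1..n}. \<iota> 0 \<noteq> \<iota> 1}"
  have finF: "finite F" 
    by (rule finite_subset[of _ "{..<L} \<rightarrow>\<^sub>E {1..n}"]) (simp_all add: F_def Collect_restrict finite_PiE)
  have \<iota>: "\<iota> t \<in> {1..n}" if "\<iota> \<in> F" "t < L" for \<iota> t
  proof -
    have "\<iota> \<in> {..<L} \<rightarrow>\<^sub>E {1..n}" using that(1) unfolding F_def mem_Collect_eq by (rule conjunct1)
    then show ?thesis by (rule PiE_mem) (use that(2) in simp)
  qed
  have "\<exists>p\<in>mpolys n. \<forall>x :: nat \<Rightarrow> 'k. mpoly_eval p x = x (\<iota> t) - (x (\<iota> 0) + of_nat t * (x (\<iota> 1) - x (\<iota> 0)))"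
    if "\<iota> \<in> F" "t < L" for \<iota> t
  proof -
    have "poly_function n (\<lambda>x :: nat \<Rightarrow> 'k. x (\<iota> t) - (x (\<iota> 0) + of_nat t * (x (\<iota> 1) - x (\<iota> 0))))"
      by (intro poly_function_diff poly_function_add poly_function_mult poly_function_const poly_function_coord \<iota>)
        (use that L in auto)
    then show ?thesis unfolding poly_function_def by metis
  qed
  then obtain p :: "(nat \<Rightarrow> nat) \<Rightarrow> nat \<Rightarrow> (nat \<Rightarrow>\<^sub>0 nat) \<Rightarrow>\<^sub>0 'k" where
    p: "\<And>\<iota> t. \<iota> \<in> F \<Longrightarrow> t < L \<Longrightarrow> p \<iota> t \<in> mpolys n"
    "\<And>\<iota> t x. \<iota> \<in> F \<Longrightarrow> t < L \<Longrightarrow> mpoly_eval (p \<iota> t) x = x (\<iota> t) - (x (\<iota> 0) + of_nat t * (x (\<iota> 1) - x (\<iota> 0)))"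
    by metis
  have zl: "x \<in> zero_locus n (p \<iota> ` {..<L}) \<longleftrightarrow>
      x \<in> affine_space n \<and> (\<forall>t<L. x (\<iota> t) = x (\<iota> 0) + of_nat t * (x (\<iota> 1) - x (\<iota> 0)))" if "\<iota> \<in> F" for \<iota> x
    using p(2)[OF that] by (auto simp: zero_locus_def)
  have "closedin (zariski n) (\<Union>\<iota>\<in>F. zero_locus n (p \<iota> ` {..<L}))"
  proof (rule closedin_Union)
    show "finite ((\<lambda>\<iota>. zero_locus n (p \<iota> ` {..<L})) ` F)" using finF by simp
    show "closedin (zariski n) Y" if "Y \<in> (\<lambda>\<iota>. zero_locus n (p \<iota> ` {..<L})) ` F" for Y
    proof -
      obtain \<iota> where "\<iota> \<in> F" "Y = zero_locus n (p \<iota> ` {..<L})" using \<open>Y \<in> _\<close> by (rule imageE)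
      moreover from this(1) have "p \<iota> ` {..<L} \<subseteq> mpolys n" using p(1) by auto
      ultimately show ?thesis unfolding closedin_zariski by metis
    qed
  qed
  then obtain S where S: "S \<subseteq> mpolys n" "(\<Union>\<iota>\<in>F. zero_locus n (p \<iota> ` {..<L})) = zero_locus n S"
    unfolding closedin_zariski by blast
  have "has_progression L (x ` {1..n}) \<longleftrightarrow> x \<in> zero_locus n S"
    if x: "x \<in> distinct_points n" for x :: "nat \<Rightarrow> 'k"
  proof
    assume "has_progression L (x ` {1..n})"
    then obtain a e where e: "e \<noteq> 0" "\<forall>t<L. a + of_nat t * e \<in> x ` {1..n}"
      unfolding has_progression_def by blast
    have "\<exists>i. i \<in> {1..n} \<and> x i = a + of_nat t * e" if t: "t < L" for t
    proof -
      have "a + of_nat t * e \<in> x ` {1..n}" using e(2) t by blast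
      then obtain i where "a + of_nat t * e = x i" "i \<in> {1..n}" by (rule imageE)
      then show ?thesis by metis
    qed
    then obtain f where f: "\<And>t. t < L \<Longrightarrow> f t \<in> {1..n} \<and> x (f t) = a + of_nat t * e" by metis
    define \<iota> where "\<iota> = restrict f {..<L}"
    have x\<iota>: "x (\<iota> t) = a + of_nat t * e" if "t < L" for t using f[OF that] that by (simp add: \<iota>_def)
    have "x (\<iota> 0) \<noteq> x (\<iota> 1)" using x\<iota>[of 0] x\<iota>[of 1] L e(1) by simp
    then have "\<iota> 0 \<noteq> \<iota> 1" by metis
    moreover have "\<iota> \<in> {..<L} \<rightarrow>\<^sub>E {1..n}" using f by (simp add: \<iota>_def restrict_PiE_iff)
    ultimately have \<iota>F: "\<iota> \<in> F" by (simp add: F_def)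
    have "x (\<iota> t) = x (\<iota> 0) + of_nat t * (x (\<iota> 1) - x (\<iota> 0))" if "t < L" for t
      using x\<iota>[of 0] x\<iota>[of 1] x\<iota>[OF that] L by simp
    moreover have "x \<in> affine_space n" using x unfolding distinct_points_def by blast
    ultimately have "x \<in> zero_locus n (p \<iota> ` {..<L})" unfolding zl[OF \<iota>F] by blast
    then show "x \<in> zero_locus n S" unfolding S(2)[symmetric] using \<iota>F by (rule UN_I[rotated])
  next
    assume "x \<in> zero_locus n S"
    then obtain \<iota> where \<iota>F: "\<iota> \<in> F" and \<iota>x: "x \<in> zero_locus n (p \<iota> ` {..<L})"
      unfolding S(2)[symmetric] by (rule UN_E)
    have eq: "x (\<iota> t) = x (\<iota> 0) + of_nat t * (x (\<iota> 1) - x (\<iota> 0))" if "t < L" for t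
      using \<iota>x that unfolding zl[OF \<iota>F] by blast
    have "\<iota> 0 \<in> {1..n}" "\<iota> 1 \<in> {1..n}" by (rule \<iota>[OF \<iota>F]; use L in simp)+
    moreover have "\<iota> 0 \<noteq> \<iota> 1" using \<iota>F by (simp add: F_def)
    ultimately have "x (\<iota> 1) - x (\<iota> 0) \<noteq> 0"
      using x inj_on_eq_iff[of x "{1..n}" "\<iota> 1" "\<iota> 0"] by (simp add: distinct_points_def)
    moreover have "x (\<iota> 0) + of_nat t * (x (\<iota> 1) - x (\<iota> 0)) \<in> x ` {1..n}" if "t < L" for t
      unfolding eq[OF that, symmetric] using \<iota>[OF \<iota>F that] by (rule imageI)
    ultimately show "has_progression L (x ` {1..n})" unfolding has_progression_def by blast
  qed
  then have "{x \<in> distinct_points n. point_class n x \<in> K} = zero_locus n S \<inter> distinct_points n"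
    using mem by blast
  moreover have "K \<subseteq> Sigma_classes n"
    unfolding K_def point_class_image[symmetric] by blast
  ultimately have "closedin (Sigma_space n) K" unfolding closedin_Sigma_space using S(1) by blast
  then show ?thesis using mem that by blast
qed

section \<open>A symmetric set of integers without a long progression\<close>

text \<open>The condition that the integers of the set constructed below satisfy: the small ones form the
  progression \<open>-(L - 3), -(L - 5), \<dots>, L - 3\<close>, where \<open>L\<close> has the same parity as \<open>n\<close>, and the others grow
  so fast that the absolute value of each is at least four times that of every smaller one.\<close>

definition sparse_value :: "nat \<Rightarrow> nat \<Rightarrow> int \<Rightarrow> bool" where
  "sparse_value n L u \<longleftrightarrow>
     (\<bar>u\<bar> \<le> int L - 3 \<and> even (u + int n + 1)) \<or> (\<exists>j. \<bar>u\<bar> = 4 * int n * 4 ^ j)"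

text \<open>Suppose the first term \<open>a\<close> has the largest absolute value \<open>M\<close>. If \<open>a\<close> is small, all terms lie in
  \<open>[-(L - 3), L - 3]\<close> and their difference is even, so there is no room for \<open>L\<close> terms. Otherwise the
  next three terms are \<open>\<plusminus> M\<close> or smaller than \<open>M / 3\<close> in absolute value. The second term cannot be
  \<open>- a\<close>, since the third would be \<open>- 3 a\<close>; so it is smaller than \<open>M / 3\<close>, which forces the third to be \<open>- a\<close>
  and the fourth to be \<open>- 2 a\<close>, a contradiction.\<close>

lemma no_progression_aux:
  assumes L: "L \<ge> 4" "L \<le> n" and e: "e \<noteq> 0" and ends: "\<bar>a + (int L - 1) * e\<bar> \<le> \<bar>a\<bar>"
    and sparse: "\<And>t. t < L \<Longrightarrow> sparse_value n L (a + int t * e)"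
  shows False
proof -
  have s0: "sparse_value n L a" and s: "sparse_value n L (a + e)" "sparse_value n L (a + 2 * e)" "sparse_value n L (a + 3 * e)"
    using sparse[of 0] sparse[of 1] sparse[of 2] sparse[of 3] L by simp_all
  have mono: "3 * e \<le> (int L - 1) * e" if "e \<ge> 0" using that L by (intro mult_right_mono) auto
  have anti: "(int L - 1) * e \<le> 3 * e" if "e \<le> 0" using that L by (intro mult_right_mono_neg) auto
  have le: "\<bar>a + e\<bar> \<le> \<bar>a\<bar>" "\<bar>a + 2 * e\<bar> \<le> \<bar>a\<bar>" "\<bar>a + 3 * e\<bar> \<le> \<bar>a\<bar>"
    using mono anti ends by linarith+
  have big: "4 * int n \<le> 4 * int n * 4 ^ j" for j :: nat
    using L by simp
  consider "\<bar>a\<bar> \<le> int L - 3" "even (a + int n + 1)" | j where "\<bar>a\<bar> = 4 * int n * 4 ^ j"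
    using s0 unfolding sparse_value_def by blast
  then show False
  proof cases
    case 1
    have "\<bar>a + e\<bar> \<noteq> 4 * int n * 4 ^ j" for j using le(1) 1(1) big[of j] L by linarith
    then have "even (a + e + int n + 1)" using s(1) unfolding sparse_value_def by blast
    then have "even e" using 1(2) by presburger
    then have "\<bar>e\<bar> \<ge> 2" using e by presburger
    then have "(int L - 1) * 2 \<le> (int L - 1) * \<bar>e\<bar>" using L by (intro mult_left_mono) auto
    also have "\<dots> = \<bar>(int L - 1) * e\<bar>" using L by (simp add: abs_mult)
    also have "\<dots> \<le> 2 * \<bar>a\<bar>"
    proof -
      have "\<bar>w\<bar> \<le> 2 * \<bar>a\<bar>" if "\<bar>a + w\<bar> \<le> \<bar>a\<bar>" for w using that by linarith
      then show ?thesis using ends .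
    qed
    also have "\<dots> \<le> 2 * (int L - 3)" using 1(1) by simp
    finally show False by simp
  next
    case (2 j)
    define M where "M = 4 * int n * 4 ^ j"
    have aM: "\<bar>a\<bar> = M" and M: "M > 0" using 2 L by (auto simp: M_def)
    have gap: "3 * \<bar>u\<bar> < M \<or> \<bar>u\<bar> = M" if u: "sparse_value n L u" "\<bar>u\<bar> \<le> M" for u
    proof -
      consider "\<bar>u\<bar> \<le> int L - 3" | i where "\<bar>u\<bar> = 4 * int n * 4 ^ i"
        using u(1) unfolding sparse_value_def by blast
      then show ?thesis
      proof cases
        case 1
        then show ?thesis using big[of j] L unfolding M_def by linarith
      next
        case (2 i)
        have "i \<le> j"
        proof (rule ccontr)
          assume "\<not> i \<le> j"
          then have "(4::int) ^ j < 4 ^ i" by simp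
          then have "M < \<bar>u\<bar>" using 2 L by (simp add: M_def)
          then show False using u(2) by simp
        qed
        then consider "i = j" | "Suc i \<le> j" by linarith
        then show ?thesis
        proof cases
          case 2
          then have "(4::int) ^ Suc i \<le> 4 ^ j" by (rule power_increasing) simp
          then have "4 * int n * 4 ^ Suc i \<le> M" unfolding M_def by (intro mult_left_mono) auto
          then have "4 * \<bar>u\<bar> \<le> M" using \<open>\<bar>u\<bar> = 4 * int n * 4 ^ i\<close> by simp
          then show ?thesis using M by linarith
        qed (use \<open>\<bar>u\<bar> = 4 * int n * 4 ^ i\<close> in \<open>simp add: M_def\<close>)
      qed
    qed
    have "3 * \<bar>a + e\<bar> < M \<or> \<bar>a + e\<bar> = M" "3 * \<bar>a + 2 * e\<bar> < M \<or> \<bar>a + 2 * e\<bar> = M"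
      "3 * \<bar>a + 3 * e\<bar> < M \<or> \<bar>a + 3 * e\<bar> = M"
      using gap s le aM by simp_all
    then show False using le e aM M by (smt (verit))
  qed
qed

text \<open>The absolute value of the terms is largest at one of the two ends; if necessary, the progression is reversed.\<close>

lemma no_progression:
  assumes L: "L \<ge> 4" "L \<le> n" and e: "e \<noteq> 0"
    and sparse: "\<And>t. t < L \<Longrightarrow> sparse_value n L (a + int t * e)"
  shows False
proof (cases "\<bar>a + (int L - 1) * e\<bar> \<le> \<bar>a\<bar>")
  case True
  then show False using no_progression_aux[OF L e] sparse by blast
next
  case False
  have "sparse_value n L ((a + (int L - 1) * e) + int t * (- e))" if "t < L" for t
  proof -
    have "int (L - 1 - t) = int L - 1 - int t" using that by simp
    then have eq: "(a + (int L - 1) * e) + int t * (- e) = a + int (L - 1 - t) * e"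
      by (simp add: algebra_simps)
    show ?thesis unfolding eq by (rule sparse) (use that in simp)
  qed
  moreover have "\<bar>(a + (int L - 1) * e) + (int L - 1) * (- e)\<bar> \<le> \<bar>a + (int L - 1) * e\<bar>"
    using False by simp
  moreover have "- e \<noteq> 0" using e by simp
  ultimately show False using no_progression_aux[OF L] by blast
qed

section \<open>The lower bound for the dimension\<close>

text \<open>An enumeration of the symmetric set with the elements \<open>\<plusminus> c 1, \<plusminus> c 2, \<dots>\<close>: the point
  \<open>(- c 1, c 1, - c 2, c 2, \<dots>)\<close>. For odd \<open>n\<close> the last coordinate is \<open>- c (n div 2 + 1)\<close>, and the
  condition \<open>c (Suc (n div 2)) = 0\<close> makes it \<open>0\<close>. The point depends linearly on \<open>c\<close>.\<close>

definition sym_point :: "nat \<Rightarrow> (nat \<Rightarrow> 'k::comm_ring_1) \<Rightarrow> nat \<Rightarrow> 'k" where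
  "sym_point n c = (\<lambda>i\<in>{1..n}. (- 1) ^ i * c ((i + 1) div 2))"

lemma sym_point_even: "j \<in> {1..n div 2} \<Longrightarrow> sym_point n c (2 * j) = c j"
  by (auto simp: sym_point_def)

lemma sym_point_odd: "j \<in> {1..n div 2} \<Longrightarrow> sym_point n c (2 * j - 1) = - c j"
proof -
  assume j: "j \<in> {1..n div 2}"
  then have "2 * j - 1 \<in> {1..n}" "(2 * j - 1 + 1) div 2 = j" "odd (2 * j - 1)" by auto
  then show ?thesis by (simp add: sym_point_def)
qed

lemma sym_point_last: "odd n \<Longrightarrow> sym_point n c n = - c (Suc (n div 2))"
proof -
  assume n: "odd n"
  then have "n \<in> {1..n}" "(n + 1) div 2 = Suc (n div 2)" by (auto elim: oddE)
  then show ?thesis using n by (simp add: sym_point_def)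
qed

lemma sym_point_index_cases:
  fixes i n :: nat
  assumes "i \<in> {1..n}"
  obtains j where "j \<in> {1..n div 2}" "i = 2 * j" | j where "j \<in> {1..n div 2}" "i = 2 * j - 1" | "odd n" "i = n"
proof (cases "even i")
  case True
  then obtain j where "i = 2 * j" by (auto elim: evenE)
  then show ?thesis using assms that(1)[of j] by auto
next
  case False
  then obtain j where j: "i = 2 * j + 1" by (auto elim: oddE)
  show ?thesis
  proof (cases "i = n")
    case True
    then show ?thesis using that(3) False by simp
  next
    case ne: False
    then have "Suc j \<in> {1..n div 2}" using j assms by auto
    then show ?thesis using that(2)[of "Suc j"] j by simp
  qed
qed

lemma sym_point_image:
  assumes "c (Suc (n div 2)) = 0"
  shows "sym_point n c ` {1..n} =
    c ` {1..n div 2} \<union> (\<lambda>j. - c j) ` {1..n div 2} \<union> (if odd n then {0} else {})" (is "?l = ?r")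
proof
  show "?l \<subseteq> ?r"
  proof
    fix u assume "u \<in> ?l"
    then obtain i where i: "i \<in> {1..n}" "u = sym_point n c i" by blast
    from i(1) show "u \<in> ?r"
      by (cases rule: sym_point_index_cases)
        (use i(2) assms in \<open>auto simp: sym_point_even sym_point_odd sym_point_last simp del: atLeastAtMost_iff One_nat_def\<close>)
  qed
  have "c j \<in> ?l" "- c j \<in> ?l" if j: "j \<in> {1..n div 2}" for j
  proof -
    have "2 * j \<in> {1..n}" "2 * j - 1 \<in> {1..n}" using j by auto
    then show "c j \<in> ?l" "- c j \<in> ?l"
      using sym_point_even[OF j, of c] sym_point_odd[OF j, of c] by (metis imageI)+
  qed
  moreover have "0 \<in> ?l" if "odd n"
  proof -
    have "n \<in> {1..n}" using that by (auto elim: oddE)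
    then show ?thesis using sym_point_last[OF that, of c] assms by (metis imageI neg_equal_0_iff_equal)
  qed
  ultimately show "?r \<subseteq> ?l" by (auto split: if_splits)
qed

lemma sym_point_distinct:
  fixes C :: "nat \<Rightarrow> int"
  assumes pos: "\<And>j. j \<in> {1..n div 2} \<Longrightarrow> C j > 0" and inj: "inj_on C {1..n div 2}" and zero: "C (Suc (n div 2)) = 0"
  shows "sym_point n (\<lambda>j. of_int (C j) :: 'k::field_char_0) \<in> distinct_points n"
proof -
  let ?x = "sym_point n C"
  let ?P = "C ` {1..n div 2}" and ?N = "(\<lambda>j. - C j) ` {1..n div 2}" and ?Z = "if odd n then {0::int} else {}"
  have "inj_on (\<lambda>j. - C j) {1..n div 2}" by (rule inj_onI) (use inj_onD[OF inj] in simp)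
  then have card: "card ?P = n div 2" "card ?N = n div 2" using inj by (simp_all add: card_image)
  have P: "u > 0" if "u \<in> ?P" for u using that pos by (elim imageE) simp
  have N: "u < 0" if "u \<in> ?N" for u using that pos by (elim imageE) simp
  have Z: "u = 0" if "u \<in> ?Z" for u using that by (simp split: if_splits)
  have disj: "?P \<inter> ?N = {}" "(?P \<union> ?N) \<inter> ?Z = {}"
  proof -
    show "?P \<inter> ?N = {}"
    proof (rule equals0I)
      fix u assume "u \<in> ?P \<inter> ?N"
      then have "u > 0" "u < 0" using P[of u] N[of u] by simp_all
      then show False by simp
    qed
    show "(?P \<union> ?N) \<inter> ?Z = {}"
    proof (rule equals0I)
      fix u assume u: "u \<in> (?P \<union> ?N) \<inter> ?Z"
      then have "u = 0" by (intro Z) (rule IntD2)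
      moreover have "u > 0 \<or> u < 0" using u P N by (elim IntE UnE) metis+
      ultimately show False by simp
    qed
  qed
  have "card (?P \<union> ?N \<union> ?Z) = card ?P + card ?N + card ?Z"
    using card_Un_disjoint[OF _ _ disj(1)] card_Un_disjoint[OF _ _ disj(2)] by simp
  also have "\<dots> = n" unfolding card by (auto elim: evenE oddE)
  finally have "card (?x ` {1..n}) = card {1..n}" using sym_point_image[of C n, OF zero] by simp
  then have "inj_on ?x {1..n}" by (intro eq_card_imp_inj_on) auto
  moreover have "sym_point n (\<lambda>j. of_int (C j) :: 'k) i = of_int (?x i)" if "i \<in> {1..n}" for i
    using that by (simp add: sym_point_def)
  ultimately have "inj_on (sym_point n (\<lambda>j. of_int (C j) :: 'k)) {1..n}"
    by (intro inj_onI) (simp add: inj_on_eq_iff)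
  then show ?thesis by (simp add: distinct_points_def affine_space_def sym_point_def)
qed

text \<open>The progression is \<open>-(L - 1), -(L - 3), \<dots>, L - 1\<close>, whose positive terms are the values
  \<open>2 j - 1 + (n mod 2)\<close> for \<open>1 \<le> j \<le> L div 2\<close>.\<close>

lemma progression_of_small_integers:
  fixes c :: "nat \<Rightarrow> 'k::field_char_0"
  assumes L: "L \<le> n" "even (n - L)" and c: "c (Suc (n div 2)) = 0"
    and small: "\<And>j. j \<in> {1..L div 2} \<Longrightarrow> c j = of_int (2 * int j - 1 + int (n mod 2))"
  shows "has_progression L (sym_point n c ` {1..n})"
proof -
  have LD: "L div 2 \<le> n div 2" using L(1) by (rule div_le_mono)
  have par: "n mod 2 = L mod 2" using L by presburger
  have "of_int (- (int L - 1)) + of_nat t * 2 \<in> sym_point n c ` {1..n}" if t: "t < L" for t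
  proof -
    define u where "u = 2 * int t - (int L - 1)"
    have eq: "of_int (- (int L - 1)) + of_nat t * 2 = (of_int u :: 'k)" by (simp add: u_def)
    have u: "\<bar>u\<bar> \<le> int L - 1" "even (u + int L + 1)" using t by (auto simp: u_def)
    show ?thesis
    proof (cases "u = 0")
      case True
      then have "odd n" using u(2) par by presburger
      then show ?thesis unfolding eq sym_point_image[of c n, OF c] using True by simp
    next
      case False
      have "even (\<bar>u\<bar> + 1 - int (L mod 2))" using u(2) by presburger
      then obtain k where k: "\<bar>u\<bar> + 1 - int (L mod 2) = 2 * k" by (rule evenE)
      have "k \<ge> 1" using k u(2) False by presburger
      moreover have "k \<le> int (L div 2)" using k u(1) by presburger
      moreover define j where "j = nat k"
      ultimately have "j \<in> {1..L div 2}" "int j = k" by auto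
      then have "\<bar>u\<bar> = 2 * int j - 1 + int (n mod 2)" "j \<in> {1..L div 2}"
        using k unfolding par by auto
      moreover from this(2) have "j \<in> {1..n div 2}" using LD by auto
      ultimately have j: "of_int \<bar>u\<bar> = c j" "j \<in> {1..n div 2}" using small by metis+
      have "of_int u = c j \<or> of_int u = - c j" unfolding j(1)[symmetric] by (cases "u \<ge> 0") simp_all
      then show ?thesis unfolding eq sym_point_image[of c n, OF c] using j(2) by blast
    qed
  qed
  then show ?thesis unfolding has_progression_def by (intro exI[of _ "of_int (- (int L - 1))"] exI[of _ 2]) auto
qed


text \<open>Let \<open>h = n div 2\<close>. The family \<open>A i\<close> fixes the first \<open>h - i\<close> values \<open>c j\<close> to be those of the progression of length
  \<open>n - 2 i\<close> and leaves the other \<open>i\<close> free. The chain consists of the closures of the images of \<open>A i\<close>,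
  where \<open>i\<close> is at most
  \<open>h - 1\<close>.\<close>

theorem krull_dim_symmetric_ge:
  fixes T :: "'k::{alg_closed_field, field_char_0} set set set"
  assumes n: "n \<ge> 3"
    and T: "\<And>B. B \<in> nsubsets n \<Longrightarrow> uminus ` B = B \<Longrightarrow> poly_class B \<in> T"
  shows "ereal (real (n div 2 - 1)) \<le> krull_dim (subtopology (Sigma_space n) T)"
proof -
  define h where "h = n div 2"
  define X where "X = subtopology (Sigma_space n) T"
  define v where "v j = 2 * int j - 1 + int (n mod 2)" for j
  define A :: "nat \<Rightarrow> (nat \<Rightarrow> 'k) set" where "A i = {x \<in> distinct_points n.
    \<exists>c. c (Suc h) = 0 \<and> (\<forall>j\<in>{1..h - i}. c j = of_int (v j)) \<and> x = sym_point n c}" for i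
  define S where "S i = point_class n ` A i" for i
  define Z where "Z i = X closure_of S i" for i
  have h1: "h \<ge> 1" using n by (simp add: h_def)
  have nh: "n = 2 * h + n mod 2" by (simp add: h_def)
  have AD: "A i \<subseteq> distinct_points n" for i by (auto simp: A_def)
  have S_X: "S i \<subseteq> topspace X" and S_T: "S i \<subseteq> T" for i
  proof -
    show "S i \<subseteq> T"
    proof
      fix s assume "s \<in> S i"
      then obtain c where x: "sym_point n c \<in> distinct_points n" and c: "c (Suc h) = 0"
        and s: "s = point_class n (sym_point n c)"
        unfolding S_def A_def by blast
      have "uminus ` (sym_point n c ` {1..n}) = sym_point n c ` {1..n}"
        unfolding sym_point_image[of c n, OF c[unfolded h_def]] by (auto simp: image_Un image_image)
      then show "s \<in> T"
        unfolding s point_class_def by (intro T distinct_points_nsubsets x)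
    qed
    moreover have "S i \<subseteq> Sigma_classes n"
      unfolding S_def point_class_image[symmetric] using AD by (intro image_mono)
    ultimately show "S i \<subseteq> topspace X" by (simp add: X_def)
  qed
  have A_mono: "A i \<subseteq> A (Suc i)" for i unfolding A_def by fastforce
  have base: "sym_point n (\<lambda>j. of_int (if j = Suc h then 0 else v j)) \<in> A 0"
  proof -
    have "sym_point n (\<lambda>j. of_int (if j = Suc h then 0 else v j) :: 'k) \<in> distinct_points n"
      by (rule sym_point_distinct) (auto simp: v_def h_def intro!: inj_onI)
    then show ?thesis
      unfolding A_def by (intro CollectI conjI exI[of _ "\<lambda>j. of_int (if j = Suc h then 0 else v j)"]) auto
  qed
  have A_ne: "A i \<noteq> {}" for i
    by (induction i) (use base A_mono in blast)+
  have A_line: "(\<lambda>i\<in>{1..n}. x i + t * (y i - x i)) \<in> A k"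
    if xy: "x \<in> A k" "y \<in> A k" and D: "(\<lambda>i\<in>{1..n}. x i + t * (y i - x i)) \<in> distinct_points n" for x y t k
  proof -
    obtain c where c: "c (Suc h) = 0" "\<forall>j\<in>{1..h - k}. c j = of_int (v j)" "x = sym_point n c"
      using xy(1) unfolding A_def by blast
    obtain c' where c': "c' (Suc h) = 0" "\<forall>j\<in>{1..h - k}. c' j = of_int (v j)" "y = sym_point n c'"
      using xy(2) unfolding A_def by blast
    define b where "b j = c j + t * (c' j - c j)" for j
    have "(\<lambda>i\<in>{1..n}. x i + t * (y i - x i)) = sym_point n b"
      unfolding c(3) c'(3) sym_point_def b_def by (intro restrict_ext) (simp add: algebra_simps)
    moreover have "b (Suc h) = 0" "\<forall>j\<in>{1..h - k}. b j = of_int (v j)"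
      using c(1,2) c'(1,2) by (simp_all add: b_def)
    ultimately show ?thesis using D unfolding A_def by blast
  qed
  have closed: "closedin X (Z i)" for i by (simp add: Z_def)
  have irr: "irreducible_space (subtopology X (Z i))" for i
    unfolding Z_def S_def X_def
    by (rule irreducible_closure_of_line_closed[OF AD A_ne S_T[unfolded S_def]]) (rule A_line)
  have strict: "Z i \<subset> Z (Suc i)" if i: "i < h - 1" for i
  proof -
    define L where "L = n - 2 * i"
    have L: "L \<ge> 4" "L \<le> n" "even (n - L)" and Lh: "L div 2 = h - i" "int L = 2 * int (h - i) + int (n mod 2)"
      using i nh unfolding L_def by auto
    obtain K :: "'k set set set" where K: "closedin (Sigma_space n) K"
      "\<And>x. x \<in> distinct_points n \<Longrightarrow> point_class n x \<in> K \<longleftrightarrow> has_progression L (x ` {1..n})"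
      using closedin_has_progression[of n L] n L(1) by auto
    have "S i \<subseteq> K \<inter> T"
    proof -
      have "point_class n x \<in> K" if x: "x \<in> A i" for x
      proof -
        obtain c where c: "c (Suc h) = 0" "\<forall>j\<in>{1..h - i}. c j = of_int (v j)" "x = sym_point n c"
          using x unfolding A_def by blast
        have "has_progression L (x ` {1..n})"
          unfolding c(3) using c(1,2) L(2,3)
          by (intro progression_of_small_integers) (simp_all only: Lh(1) h_def v_def)
        then show ?thesis using K(2) x AD by blast
      qed
      then show ?thesis using S_T unfolding S_def by blast
    qed
    moreover have "closedin X (K \<inter> T)" unfolding X_def closedin_subtopology using K(1) by blast
    ultimately have ZK: "Z i \<subseteq> K" unfolding Z_def using closure_of_minimal by blast
    \<comment> \<open>A member of the next family without a progression of length \<open>L\<close>: the free values grow geometrically.\<close>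
    define C where "C j = (if j = Suc h then 0 else if j < h - i then v j else 4 * int n * 4 ^ j)" for j
    let ?x = "sym_point n (\<lambda>j. of_int (C j) :: 'k)"
    have vn: "v j < 4 * int n * 4 ^ k" if "j \<le> h" for j k
    proof -
      have "v j < 4 * int n" using that nh h1 unfolding v_def by linarith
      also have "\<dots> \<le> 4 * int n * 4 ^ k" using n by simp
      finally show ?thesis .
    qed
    have x: "?x \<in> distinct_points n"
    proof (rule sym_point_distinct)
      show "C j > 0" if "j \<in> {1..n div 2}" for j
        using that n unfolding C_def v_def h_def[symmetric] by auto
      show "C (Suc (n div 2)) = 0" by (simp add: C_def h_def)
      have "C j < C k" if jk: "j < k" "k \<le> h" for j k
      proof -
        consider "k < h - i" | "j < h - i" "\<not> k < h - i" | "\<not> j < h - i" using jk by linarith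
        then show ?thesis
        proof cases
          case 3
          have "(4::int) ^ j < 4 ^ k" using jk by simp
          then show ?thesis using 3 jk n by (simp add: C_def)
        qed (use jk vn in \<open>auto simp: C_def v_def\<close>)
      qed
      then have "strict_mono_on {1..n div 2} C" by (auto simp: strict_mono_on_def h_def)
      then show "inj_on C {1..n div 2}" by (rule strict_mono_on_imp_inj_on)
    qed
    have "?x \<in> A (Suc i)"
      unfolding A_def using x
      by (intro CollectI conjI exI[of _ "\<lambda>j. of_int (C j)"]) (auto simp: C_def)
    then have "point_class n ?x \<in> Z (Suc i)"
      using closure_of_subset[OF S_X] unfolding Z_def S_def by blast
    moreover have "\<not> has_progression L (?x ` {1..n})"
    proof
      assume "has_progression L (?x ` {1..n})"
      then obtain a e where e: "e \<noteq> 0" and mem: "\<And>t. t < L \<Longrightarrow> a + of_nat t * e \<in> ?x ` {1..n}"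
        unfolding has_progression_def by blast
      have sparse: "\<exists>u. a + of_nat t * e = of_int u \<and> sparse_value n L u" if t: "t < L" for t
      proof -
        have C: "sparse_value n L (C j)" "sparse_value n L (- C j)" if j: "j \<in> {1..h}" for j
        proof -
          show "sparse_value n L (C j)"
          proof (cases "j < h - i")
            case True
            have "v j \<le> int L - 3" "v j \<ge> 0" "even (v j + int n + 1)"
              using True j nh unfolding v_def Lh(2) by auto
            then show ?thesis using True j by (simp add: sparse_value_def C_def)
          next
            case False
            then have "\<bar>C j\<bar> = 4 * int n * 4 ^ j" using j by (simp add: C_def)
            then show ?thesis unfolding sparse_value_def by blast
          qed
          then show "sparse_value n L (- C j)" by (auto simp: sparse_value_def)
        qed
        have z: "sparse_value n L 0" if "odd n" using that L(1) by (simp add: sparse_value_def)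
        have "(\<lambda>j. of_int (C j) :: 'k) (Suc (n div 2)) = 0" by (simp add: C_def h_def)
        from mem[OF t, unfolded sym_point_image[where c = "\<lambda>j. of_int (C j) :: 'k", OF this]]
        consider j where "j \<in> {1..h}" "a + of_nat t * e = of_int (C j)"
          | j where "j \<in> {1..h}" "a + of_nat t * e = of_int (- C j)"
          | "odd n" "a + of_nat t * e = of_int 0"
          by (auto simp: h_def simp del: One_nat_def atLeastAtMost_iff split: if_splits)
        then show ?thesis using C z by cases metis+
      qed
      obtain a0 where a0: "a = of_int a0" using sparse[of 0] L(1) by auto
      obtain a1 where a1: "a + e = of_int a1" using sparse[of 1] L(1) by auto
      define e0 where "e0 = a1 - a0"
      have e0: "e = of_int e0" using a0 a1 by (simp add: e0_def algebra_simps)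
      have "sparse_value n L (a0 + int t * e0)" if t: "t < L" for t
      proof -
        obtain u where u: "a + of_nat t * e = of_int u" "sparse_value n L u" using sparse[OF t] by blast
        then have "of_int u = (of_int (a0 + int t * e0) :: 'k)" by (simp add: a0 e0)
        then show ?thesis using u(2) by (simp only: of_int_eq_iff)
      qed
      moreover have "e0 \<noteq> 0" using e e0 by auto
      ultimately show False using no_progression[OF L(1,2)] by blast
    qed
    then have "point_class n ?x \<notin> Z i" using K(2)[OF x] ZK by blast
    moreover have "Z i \<subseteq> Z (Suc i)"
      unfolding Z_def S_def using A_mono by (intro closure_of_mono image_mono)
    ultimately show ?thesis by blast
  qed
  have "ereal (real (h - 1)) \<in> {ereal (real m) | m. \<exists>Z.
      (\<forall>i\<le>m. closedin X (Z i) \<and> irreducible_space (subtopology X (Z i))) \<and> (\<forall>i<m. Z i \<subset> Z (Suc i))}"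
    using closed irr strict by blast
  then show ?thesis unfolding krull_dim_def X_def[symmetric] h_def[symmetric] by (rule Sup_upper)
qed

section \<open>The dimension of the exceptional classes\<close>

theorem corollary38:
  fixes n :: nat
  assumes "n \<ge> 3"
  shows "(even n \<longrightarrow>
            krull_dim (subtopology (Sigma_space n)
              (exceptional_classes n :: 'k::{alg_closed_field, field_char_0} set set set))
              = ereal ((real n - 2) / 2) \<and>
            krull_dim (subtopology (Sigma_space n)
              (even_exceptional_classes n :: 'k set set set))
              = ereal ((real n - 2) / 2)) \<and>
         (odd n \<longrightarrow>
            krull_dim (subtopology (Sigma_space n)
              (exceptional_classes n :: 'k set set set))
              = ereal ((real n - 3) / 2) \<and>
            krull_dim (subtopology (Sigma_space n)
              (even_exceptional_classes n :: 'k set set set))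
              = ereal ((real n - 3) / 2))"
proof -
  have sub: "even_exceptional_classes n \<subseteq> (exceptional_classes n :: 'k set set set)"
    by (auto simp: even_exceptional_classes_def exceptional_classes_def)
  have sym: "poly_class B \<in> even_exceptional_classes n"
    if "B \<in> nsubsets n" "uminus ` B = B" for B :: "'k set"
    using that assms symmetric_exceptional_set[of n B] symmetric_even_char_perm_group[of n B]
    unfolding even_exceptional_classes_def by auto
  have dim: "krull_dim (subtopology (Sigma_space n) T) = ereal (real (n div 2 - 1))"
    if "even_exceptional_classes n \<subseteq> T" "T \<subseteq> exceptional_classes n" for T :: "'k set set set"
    using krull_dim_exceptional_le[OF assms that(2)] krull_dim_symmetric_ge[OF assms, of T] sym that(1)
    by (intro antisym) blast+
  have "real (n div 2 - 1) = (real n - 2) / 2" if "even n"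
    using that assms by (auto elim!: evenE simp: of_nat_diff)
  moreover have "real (n div 2 - 1) = (real n - 3) / 2" if "odd n"
    using that assms by (auto elim!: oddE simp: of_nat_diff)
  ultimately show ?thesis
    using dim[OF sub order_refl] dim[OF order_refl sub] by simp
qed

end
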